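(* Let $\zeta_3$ be a primitive cube root of unity. Then \[ \sum_{n=0}^\infty\sum_{m=-\infty}^\infty M2(m,n)\zeta_3^mq^n=M2_{0,3}(q^3)+qM2_{1,3}(q^3)+q^2M2_{2,3}(q^3), \] where \begin{align*} M2_{0,3}(q)&=\frac{(q^6;q^6)_\infty^{10}(q^4;q^4)_\infty(q;q)_\infty}{(q^{12};q^{12})_\infty^4(q^3;q^3)_\infty^4(q^2;q^2)_\infty^3},\qquad M2_{1,3}(q)=\frac{(q^6;q^6)_\infty^4}{(q^{12};q^{12})_\infty(q^3;q^3)_\infty(q^2;q^2)_\infty},\\ M2_{2,3}(q)&=-2\frac{(q^{12};q^{12})_\infty^2(q^3;q^3)_\infty^2(q^2;q^2)_\infty}{(q^6;q^6)_\infty^2(q^4;q^4)_\infty(q;q)_\infty}. \end{align*}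
   Context: $(a;q)_\infty=\prod_{k\ge0}(1-aq^k)$. The numbers $M2(m,n)$ are defined by \[ \sum_{n\ge0}\sum_mM2(m,n)z^mq^n=\frac{(-q;q^2)_\infty(q^2;q^2)_\infty}{(zq^2;q^2)_\infty(z^{-1}q^2;q^2)_\infty}. \] *)

theory Defs
  imports "HOL-Analysis.Analysis" "HOL-Computational_Algebra.Formal_Laurent_Series"
begin

text \<open>Infinite q-Pochhammer product as a formal power series in q:
  fps_qpoch a b = prod_{k>=0} (1 - a * b^k), intended for a, b with zero constant term
  (then the n-th coefficient is already determined by the factors k <= n).\<close>
definition fps_qpoch :: "'a::comm_ring_1 fps \<Rightarrow> 'a fps \<Rightarrow> 'a fps" where
  "fps_qpoch a b = Abs_fps (\<lambda>n. (\<Prod>k<Suc n. 1 - a * b ^ k) $ n)"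

abbreviation qp :: "nat \<Rightarrow> 'a::comm_ring_1 fps" where
  "qp j \<equiv> fps_qpoch (fps_X ^ j) (fps_X ^ j)"

text \<open>Two-variable generating function: power series in q whose coefficients are
  Laurent series (in fact Laurent polynomials) in z.\<close>
definition M2_gf :: "complex fls fps" where
  "M2_gf = fps_qpoch (- fps_X) (fps_X ^ 2) * qp 2
     / (fps_qpoch (fps_const fls_X * fps_X ^ 2) (fps_X ^ 2)
        * fps_qpoch (fps_const fls_X_inv * fps_X ^ 2) (fps_X ^ 2))"

definition M2 :: "int \<Rightarrow> nat \<Rightarrow> complex" where
  "M2 m n = fls_nth (fps_nth M2_gf n) m"

definition M2_03 :: "complex fps" where
  "M2_03 = (qp 6 ^ 10 * qp 4 * qp 1) / (qp 12 ^ 4 * qp 3 ^ 4 * qp 2 ^ 3)"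

definition M2_13 :: "complex fps" where
  "M2_13 = qp 6 ^ 4 / (qp 12 * qp 3 * qp 2)"

definition M2_23 :: "complex fps" where
  "M2_23 = - 2 * (qp 12 ^ 2 * qp 3 ^ 2 * qp 2) / (qp 6 ^ 2 * qp 4 * qp 1)"

end

(*
  For a primitive cube root of unity zeta the generating function becomes H / (q^6;q^6), where
  H = psi(q) phi(-q^2) = phi(q) psi(-q) with Ramanujan's theta functions phi and psi.
  By the Jacobi triple product and splitting the summation index modulo 3,
    phi(q) = phi(q^9) + 2 q Omega(q^3)  and  psi(q) = A(q^3) + q psi(q^9),
  where A and Omega are again theta series with product expansions. The factorisation
  psi(q) phi(-q^2) gives the components of H in q Z[[q^3]] and q^2 Z[[q^3]] as single products,
  but the component in Z[[q^3]] only as a difference of two; the factorisation phi(q) psi(-q)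
  gives the latter as a single product, so no further eta quotient identity is needed.
*)
theory Submission
  imports Defs
begin

text \<open>Residues modulo 3 decide which factorisation yields which component. Exponents in psi(q)
  lie in classes 0 and 1, those in phi(-q^2) in classes 0 and 2; so class 1 arises only as 1+0 and
  class 2 only as 0+2, while class 0 arises both as 0+0 and as 1+2. In phi(q) psi(-q) both factors
  have classes 0 and 1, and class 0 is 0+0 alone. Theta series are indexed by the two exponents in
  Ramanujan's f: \<open>theta 1 1\<close> is phi, \<open>theta 5 1\<close> is Omega,
  \<open>theta 2 1\<close> is A, and \<open>theta 1 0\<close> is 2 psi, since a sum over all
  integers meets every triangular number twice. Hence the factors 2 throughout. Two formal obstacles
  shape the rest. Setting z = zeta in a quotient of series over Laurent series in z has no meaning
  until its coefficients are known to be Laurent polynomials. And power series form no field, so eta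
  quotients are computed with as Laurent series in q.\<close>

section \<open>Congruences modulo powers of \<open>fps_X\<close>\<close>

lemma fps_X_power_dvd_iff:
  fixes f :: "'a::comm_ring_1 fps"
  shows "fps_X ^ d dvd f \<longleftrightarrow> (\<forall>i<d. f $ i = 0)"
proof
  assume "fps_X ^ d dvd f"
  then show "\<forall>i<d. f $ i = 0"
    by (auto simp: dvd_def fps_X_power_mult_nth)
next
  assume f: "\<forall>i<d. f $ i = 0"
  have "f = fps_X ^ d * fps_shift d f"
    by (rule fps_ext) (use f in \<open>auto simp: fps_X_power_mult_nth\<close>)
  then show "fps_X ^ d dvd f" ..
qed

lemma fps_X_power_dvd_nth_eq:
  fixes f g :: "'a::comm_ring_1 fps"
  shows "fps_X ^ d dvd f - g \<Longrightarrow> i < d \<Longrightarrow> f $ i = g $ i"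
  by (auto simp: fps_X_power_dvd_iff)

lemma dvd_diff_mult_mono:
  fixes d :: "'a::comm_ring_1"
  assumes "d dvd a - a'" "d dvd b - b'"
  shows "d dvd a * b - a' * b'"
proof -
  have "a * b - a' * b' = (a - a') * b + a' * (b - b')"
    by (simp add: algebra_simps)
  then show ?thesis
    using assms by (metis dvd_add dvd_mult dvd_mult2)
qed

section \<open>Infinite products\<close>

lemma fps_X_dvd_iff: "fps_X dvd (f :: 'a::comm_ring_1 fps) \<longleftrightarrow> f $ 0 = 0"
  using fps_X_power_dvd_iff[of 1 f] by simp

lemma prod_qpoch_dvd_diff:
  fixes a b :: "'a::comm_ring_1 fps"
  assumes a: "fps_X ^ m dvd a" and b: "b $ 0 = 0" and "M \<le> N"
  shows "fps_X ^ (M + m) dvd (\<Prod>k<N. 1 - a * b ^ k) - (\<Prod>k<M. 1 - a * b ^ k)"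
  using \<open>M \<le> N\<close>
proof (induction N rule: dec_induct)
  case (step N)
  have "fps_X ^ N dvd b ^ N"
    using b by (simp add: dvd_power_same fps_X_dvd_iff)
  then have "fps_X ^ (N + m) dvd a * b ^ N"
    using mult_dvd_mono[OF a, of "fps_X ^ N" "b ^ N"] by (simp add: power_add mult.commute)
  then have "fps_X ^ (M + m) dvd a * b ^ N"
    using step.hyps by (meson add_le_mono1 dvd_trans le_imp_power_dvd)
  then have "fps_X ^ (M + m) dvd ((\<Prod>k<N. 1 - a * b ^ k) - (\<Prod>k<M. 1 - a * b ^ k))
      - (\<Prod>k<N. 1 - a * b ^ k) * (a * b ^ N)"
    using step.IH by (simp add: dvd_diff)
  then show ?case
    by (simp add: algebra_simps)
qed simp

text \<open>Every factor left out contributes a multiple of \<open>a * b ^ k\<close> with k at least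
  \<open>N\<close>. The case \<open>m = 0\<close> admits \<open>a\<close> with nonzero constant
  term, as in (-1;q); the case \<open>m = 1\<close> gains one order of precision for (p;p).\<close>

lemma fps_qpoch_dvd_diff:
  fixes a b :: "'a::comm_ring_1 fps"
  assumes a: "fps_X ^ m dvd a" and b: "b $ 0 = 0"
  shows "fps_X ^ (N + m) dvd fps_qpoch a b - (\<Prod>k<N. 1 - a * b ^ k)"
  unfolding fps_X_power_dvd_iff
proof safe
  fix i assume "i < N + m"
  \<comment> \<open>The definition reads coefficient \<open>i\<close> off \<open>Suc i\<close>
    factors, which may be fewer or more than \<open>N\<close>; the longer product is compared with
    both.\<close>
  have "(\<Prod>k<max (Suc i) N. 1 - a * b ^ k) $ i = (\<Prod>k<Suc i. 1 - a * b ^ k) $ i"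
    by (rule fps_X_power_dvd_nth_eq[OF prod_qpoch_dvd_diff[OF a b]]) auto
  moreover have "(\<Prod>k<max (Suc i) N. 1 - a * b ^ k) $ i = (\<Prod>k<N. 1 - a * b ^ k) $ i"
    by (rule fps_X_power_dvd_nth_eq[OF prod_qpoch_dvd_diff[OF a b]]) (use \<open>i < N + m\<close> in auto)
  ultimately show "(fps_qpoch a b - (\<Prod>k<N. 1 - a * b ^ k)) $ i = 0"
    by (simp add: fps_qpoch_def)
qed

lemma fps_qpoch_nth:
  fixes a b :: "'a::comm_ring_1 fps"
  assumes "b $ 0 = 0" "n < N"
  shows "fps_qpoch a b $ n = (\<Prod>k<N. 1 - a * b ^ k) $ n"
  using fps_X_power_dvd_nth_eq[OF fps_qpoch_dvd_diff[of 0 a b N]] assms by simp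

lemma fps_qpoch_nth_0: "fps_qpoch a b $ 0 = 1 - a $ 0"
  by (simp add: fps_qpoch_def)

lemma fps_eq_if_dvd_diff:
  fixes f g :: "'a::comm_ring_1 fps"
  assumes "\<And>N. fps_X ^ N dvd f - g"
  shows "f = g"
  by (rule fps_ext) (use fps_X_power_dvd_nth_eq[OF assms] in blast)

lemma fps_qpoch_eqI:
  fixes a b :: "'a::comm_ring_1 fps"
  assumes "b $ 0 = 0" "\<And>N. fps_X ^ N dvd (\<Prod>k<N. 1 - a * b ^ k) - f"
  shows "fps_qpoch a b = f"
proof (rule fps_eq_if_dvd_diff)
  fix N
  show "fps_X ^ N dvd fps_qpoch a b - f"
    using dvd_add[OF fps_qpoch_dvd_diff[of 0 a b N, simplified, OF assms(1)] assms(2)[of N]] by simp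
qed

text \<open>The factors are sorted by their index modulo \<open>r\<close>: \<open>N\<close> factors
  of each of the \<open>r\<close> products together make up the first \<open>N * r\<close> factors
  of the undivided one.\<close>

lemma fps_qpoch_split:
  fixes x p :: "'a::comm_ring_1 fps"
  assumes p: "p $ 0 = 0" and "r > 0"
  shows "(\<Prod>i<r. fps_qpoch (x * p ^ i) (p ^ r)) = fps_qpoch x p"
proof (rule fps_eq_if_dvd_diff)
  fix N
  have pr: "(p ^ r) $ 0 = 0"
    using p \<open>r > 0\<close> by (rule startsby_zero_power)
  have 1: "fps_X ^ N dvd fps_qpoch (x * p ^ i) (p ^ r) - (\<Prod>k<N. 1 - x * p ^ i * (p ^ r) ^ k)" for i
    using fps_qpoch_dvd_diff[of 0 _ "p ^ r" N] pr by simp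
  have 2: "fps_X ^ N dvd (\<Prod>i<s. fps_qpoch (x * p ^ i) (p ^ r))
      - (\<Prod>i<s. \<Prod>k<N. 1 - x * p ^ i * (p ^ r) ^ k)" for s
  proof (induction s)
    case (Suc s)
    then show ?case
      using dvd_diff_mult_mono[OF Suc 1[of s]] by simp
  qed simp
  have "(\<Prod>i<r. \<Prod>k<N. 1 - x * p ^ i * (p ^ r) ^ k) = (\<Prod>k<N. \<Prod>i<r. 1 - x * p ^ (k * r + i))"
    by (subst prod.swap) (simp add: power_add mult_ac flip: power_mult)
  also have "\<dots> = (\<Prod>k<N. \<Prod>i\<in>{k * r..<k * r + r}. 1 - x * p ^ i)"
    using prod.atLeastLessThan_shift_0[of "\<lambda>i. 1 - x * p ^ i"]
    by (simp add: lessThan_atLeast0)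
  also have "\<dots> = (\<Prod>i<N * r. 1 - x * p ^ i)"
    by (rule prod.nat_group)
  finally have 3: "(\<Prod>i<r. \<Prod>k<N. 1 - x * p ^ i * (p ^ r) ^ k) = (\<Prod>i<N * r. 1 - x * p ^ i)" .
  have 4: "fps_X ^ N dvd fps_qpoch x p - (\<Prod>i<N * r. 1 - x * p ^ i)"
  proof (rule dvd_trans)
    show "fps_X ^ N dvd (fps_X ^ (N * r) :: 'a fps)"
      using \<open>r > 0\<close> by (intro le_imp_power_dvd) simp
    show "fps_X ^ (N * r) dvd fps_qpoch x p - (\<Prod>i<N * r. 1 - x * p ^ i)"
      using fps_qpoch_dvd_diff[of 0 x p "N * r"] p by simp
  qed
  show "fps_X ^ N dvd (\<Prod>i<r. fps_qpoch (x * p ^ i) (p ^ r)) - fps_qpoch x p"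
    using dvd_diff[OF 2[of r] 4] by (simp add: 3)
qed

lemma fps_qpoch_mult_uminus:
  fixes x p :: "'a::comm_ring_1 fps"
  assumes p: "p $ 0 = 0"
  shows "fps_qpoch (- x) p * fps_qpoch x p = fps_qpoch (x\<^sup>2) (p\<^sup>2)"
proof (rule sym, rule fps_qpoch_eqI)
  fix N
  have "(\<Prod>k<N. 1 - x\<^sup>2 * (p\<^sup>2) ^ k) = (\<Prod>k<N. (1 - - x * p ^ k) * (1 - x * p ^ k))"
    by (intro prod.cong) (simp_all add: algebra_simps power2_eq_square power_mult_distrib)
  also have "\<dots> = (\<Prod>k<N. (1 - - x * p ^ k)) * (\<Prod>k<N. 1 - x * p ^ k)"
    by (rule prod.distrib)
  finally have *: "(\<Prod>k<N. 1 - x\<^sup>2 * (p\<^sup>2) ^ k) = \<dots>" .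
  have "fps_X ^ N dvd fps_qpoch (- x) p * fps_qpoch x p
      - (\<Prod>k<N. (1 - - x * p ^ k)) * (\<Prod>k<N. 1 - x * p ^ k)"
    using fps_qpoch_dvd_diff[of 0 "- x" p N] fps_qpoch_dvd_diff[of 0 x p N] p by (intro dvd_diff_mult_mono) auto
  then show "fps_X ^ N dvd (\<Prod>k<N. 1 - x\<^sup>2 * (p\<^sup>2) ^ k) - fps_qpoch (- x) p * fps_qpoch x p"
    unfolding * by (metis dvd_minus_iff minus_diff_eq)
qed (use p in \<open>simp add: power2_eq_square\<close>)

lemma fps_qpoch_compose:
  fixes a b c :: "'a::idom fps"
  assumes b: "b $ 0 = 0" and c: "c $ 0 = 0"
  shows "fps_qpoch a b oo c = fps_qpoch (a oo c) (b oo c)"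
proof (rule fps_ext)
  fix n
  have "(fps_qpoch a b oo c) $ n = ((\<Prod>k<Suc n. 1 - a * b ^ k) oo c) $ n"
    \<comment> \<open>Coefficient \<open>n\<close> of a composition involves only coefficients up to
      \<open>n\<close> of the outer series, so one finite product serves for all of them.\<close>
    unfolding fps_compose_nth
    by (intro sum.cong refl) (simp add: fps_qpoch_nth[OF b, of _ "Suc n"] del: prod.lessThan_Suc)
  also have "(\<Prod>k<Suc n. 1 - a * b ^ k) oo c = (\<Prod>k<Suc n. 1 - (a oo c) * (b oo c) ^ k)"
    using c by (simp add: fps_compose_prod_distrib fps_compose_sub_distrib fps_compose_mult_distrib
        fps_compose_power del: prod.lessThan_Suc)
  also have "\<dots> $ n = fps_qpoch (a oo c) (b oo c) $ n"
    by (simp add: fps_qpoch_def)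
  finally show "(fps_qpoch a b oo c) $ n = fps_qpoch (a oo c) (b oo c) $ n" .
qed

section \<open>The Jacobi triple product\<close>

text \<open>This is the Gaussian binomial [m+k choose k] in base \<open>p\<close>. Indexing by the
  two complementary parts and recursing by Pascal's rule keeps it free of division and of a
  condition k <= n.\<close>

fun gauss_binom :: "'a::comm_ring_1 \<Rightarrow> nat \<Rightarrow> nat \<Rightarrow> 'a" where
  "gauss_binom p 0 k = 1"
| "gauss_binom p (Suc m) 0 = 1"
| "gauss_binom p (Suc m) (Suc k) = gauss_binom p m (Suc k) + p ^ Suc m * gauss_binom p (Suc m) k"

lemma gauss_binom_0_right [simp]: "gauss_binom p m 0 = 1"
  by (cases m) auto

lemma gauss_binom_mult:
  "gauss_binom p m k * (\<Prod>i<m. 1 - p * p ^ i) * (\<Prod>i<k. 1 - p * p ^ i) = (\<Prod>i<m + k. 1 - p * p ^ i)"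
proof (induction p m k rule: gauss_binom.induct)
  case (3 p m k)
  let ?Q = "\<lambda>n. \<Prod>i<n. 1 - p * p ^ i"
  have "gauss_binom p (Suc m) (Suc k) * ?Q (Suc m) * ?Q (Suc k)
      = (gauss_binom p m (Suc k) * ?Q m * ?Q (Suc k)) * (1 - p * p ^ m)
      + p ^ Suc m * (1 - p * p ^ k) * (gauss_binom p (Suc m) k * ?Q (Suc m) * ?Q k)"
    by (simp add: algebra_simps)
  also have "\<dots> = ?Q (m + Suc k) * (1 - p * p ^ m) + p ^ Suc m * (1 - p * p ^ k) * ?Q (Suc m + k)"
    by (simp only: 3)
  also have "\<dots> = ?Q (Suc m + Suc k)"
    by (simp add: algebra_simps power_add)
  finally show ?case .
qed auto

text \<open>The recursion is not symmetric in its two arguments, but the factorial formula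
  \<open>gauss_binom_mult\<close> is, and its products can be cancelled because their constant term
  is 1.\<close>

lemma gauss_binom_commute:
  fixes p :: "'a::idom fps"
  assumes "p $ 0 = 0"
  shows "gauss_binom p m k = gauss_binom p k m"
proof -
  let ?Q = "\<lambda>n. \<Prod>i<n. 1 - p * p ^ i"
  have nz: "?Q n \<noteq> 0" for n
  proof -
    have "?Q n $ 0 = 1"
      by (induction n) (simp_all add: assms)
    then show ?thesis
      by (metis fps_zero_nth zero_neq_one)
  qed
  have "gauss_binom p m k * (?Q m * ?Q k) = gauss_binom p k m * (?Q m * ?Q k)"
    using gauss_binom_mult[of p m k] gauss_binom_mult[of p k m] by (simp add: mult_ac add.commute)
  then show ?thesis
    using nz by simp
qed

text \<open>Pascal's rule summed against an arbitrary weight \<open>f\<close>: this is the step that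
  adds one factor to a finite triple product.\<close>

lemma sum_gauss_binom_Suc:
  "(\<Sum>j\<le>Suc S. gauss_binom p j (Suc S - j) * f j)
    = (\<Sum>j\<le>S. gauss_binom p j (S - j) * f (Suc j)) + (\<Sum>j\<le>S. gauss_binom p j (S - j) * (p ^ j * f j))"
proof (cases S)
  case (Suc T)
  have "(\<Sum>j\<le>Suc S. gauss_binom p j (Suc S - j) * f j)
      = f 0 + (\<Sum>j\<le>T. gauss_binom p (Suc j) (S - j) * f (Suc j)) + f (Suc S)"
    unfolding Suc by (subst sum.atMost_Suc, subst sum.atMost_Suc_shift) simp
  also have "(\<Sum>j\<le>T. gauss_binom p (Suc j) (S - j) * f (Suc j))
      = (\<Sum>j\<le>T. gauss_binom p j (S - j) * f (Suc j)
            + gauss_binom p (Suc j) (T - j) * (p ^ Suc j * f (Suc j)))"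
    by (intro sum.cong refl) (simp add: Suc Suc_diff_le algebra_simps)
  also have "f 0 + \<dots> + f (Suc S)
      = ((\<Sum>j\<le>T. gauss_binom p j (S - j) * f (Suc j)) + f (Suc S))
      + (f 0 + (\<Sum>j\<le>T. gauss_binom p (Suc j) (T - j) * (p ^ Suc j * f (Suc j))))"
    by (simp add: sum.distrib algebra_simps)
  also have "(\<Sum>j\<le>T. gauss_binom p j (S - j) * f (Suc j)) + f (Suc S)
      = (\<Sum>j\<le>S. gauss_binom p j (S - j) * f (Suc j))"
    by (simp add: Suc)
  also have "f 0 + (\<Sum>j\<le>T. gauss_binom p (Suc j) (T - j) * (p ^ Suc j * f (Suc j)))
      = (\<Sum>j\<le>S. gauss_binom p j (S - j) * (p ^ j * f j))"
    unfolding Suc by (subst sum.atMost_Suc_shift) simp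
  finally show ?thesis .
qed (simp add: algebra_simps)

text \<open>The other Pascal rule, obtained from the previous one by reversing the summation and
  using symmetry.\<close>

lemma sum_gauss_binom_Suc':
  fixes p :: "'a::idom fps"
  assumes "p $ 0 = 0"
  shows "(\<Sum>j\<le>Suc S. gauss_binom p j (Suc S - j) * f j)
    = (\<Sum>j\<le>S. gauss_binom p j (S - j) * (p ^ (S - j) * f (Suc j))) + (\<Sum>j\<le>S. gauss_binom p j (S - j) * f j)"
proof -
  have rev: "(\<Sum>j\<le>n. gauss_binom p j (n - j) * g j) = (\<Sum>j\<le>n. gauss_binom p j (n - j) * g (n - j))"
    for n and g :: "nat \<Rightarrow> 'a fps"
  proof -
    have "(\<Sum>j\<le>n. gauss_binom p j (n - j) * g j)
        = (\<Sum>j\<le>n. gauss_binom p (n - j) (n - (n - j)) * g (n - j))"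
      using sum.nat_diff_reindex[of "\<lambda>j. gauss_binom p j (n - j) * g j" "Suc n"]
      by (simp only: lessThan_Suc_atMost diff_Suc_Suc)
    also have "\<dots> = (\<Sum>j\<le>n. gauss_binom p j (n - j) * g (n - j))"
      by (intro sum.cong refl) (simp add: gauss_binom_commute[OF assms, of "n - _"])
    finally show ?thesis .
  qed
  show ?thesis
    by (subst (1 2 3) rev, subst sum_gauss_binom_Suc) (auto intro!: sum.cong simp: Suc_diff_le add.commute)
qed


text \<open>For \<open>a = X\<^sup>\<alpha>\<close> and \<open>b = X\<^sup>\<beta>\<close> this is the exponent of
  \<open>a\<^bsup>n(n+1)/2\<^esup> b\<^bsup>n(n-1)/2\<^esup>\<close>, the general term of Ramanujan's \<open>f(a, b)\<close>.\<close>

definition theta_exp :: "nat \<Rightarrow> nat \<Rightarrow> int \<Rightarrow> nat" where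
  "theta_exp \<alpha> \<beta> n = nat ((int \<alpha> * (n * (n + 1)) + int \<beta> * (n * (n - 1))) div 2)"

text \<open>Removes both \<open>nat\<close> and the halving, so that identities between exponents
  become polynomial identities over the integers.\<close>

lemma two_theta_exp: "2 * int (theta_exp \<alpha> \<beta> n) = int \<alpha> * (n * (n + 1)) + int \<beta> * (n * (n - 1))"
proof -
  have "n * (n + 1) \<ge> 0" "n * (n - 1) \<ge> 0"
    by (auto simp: zero_le_mult_iff)
  moreover have "even (n * (n + 1))" "even (n * (n - 1))"
    by auto
  ultimately show ?thesis
    by (simp add: theta_exp_def)
qed

text \<open>Makes fibres finite and controls truncation. The summand 1 is needed:
  \<open>theta_exp 1 0 (- 1)\<close> is 0.\<close>

lemma theta_exp_lower:
  assumes "\<alpha> + \<beta> > 0"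
  shows "\<bar>n\<bar> \<le> int (theta_exp \<alpha> \<beta> n) + 1"
proof -
  define u where "u = n * (n + 1)"
  define v where "v = n * (n - 1)"
  have uv: "u \<ge> 0" "v \<ge> 0"
    by (auto simp: zero_le_mult_iff u_def v_def)
  \<comment> \<open>The minimum equals n^2 - |n|, and no integer lies strictly between 1 and
    2.\<close>
  have "min u v \<ge> 2 * \<bar>n\<bar> - 2"
  proof -
    have "0 \<le> (\<bar>n\<bar> - 1) * (\<bar>n\<bar> - 2)"
      by (auto simp: zero_le_mult_iff)
    then have "2 * \<bar>n\<bar> - 2 \<le> \<bar>n\<bar> * \<bar>n\<bar> - \<bar>n\<bar>"
      by (simp add: algebra_simps)
    then show ?thesis
      by (auto simp: u_def v_def algebra_simps abs_if split: if_splits)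
  qed
  moreover have "int \<alpha> * u + int \<beta> * v \<ge> min u v"
  proof (cases "\<alpha> = 0")
    case True
    then have "int \<beta> * v \<ge> 1 * v"
      using assms uv by (intro mult_right_mono) auto
    then show ?thesis using True by simp
  next
    case False
    then have "int \<alpha> * u \<ge> 1 * u"
      using uv by (intro mult_right_mono) auto
    moreover have "int \<beta> * v \<ge> 0" using uv by simp
    ultimately show ?thesis by linarith
  qed
  ultimately show ?thesis
    using two_theta_exp[of \<alpha> \<beta> n] unfolding u_def v_def by linarith
qed

text \<open>Induction on \<open>N\<close>, whose base case is an induction on \<open>M\<close>. A
  further factor of the first product needs the reversed Pascal rule; a further factor of the second
  needs the direct one and moves the centre of summation by one.\<close>

lemma finite_jacobi_triple_product:
  fixes \<alpha> \<beta> :: nat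
  assumes s: "\<alpha> + \<beta> > 0"
  defines "X \<equiv> fps_X :: 'a::idom fps" and "p \<equiv> fps_X ^ (\<alpha> + \<beta>) :: 'a fps"
  shows "(\<Prod>k<M. 1 + X ^ \<alpha> * p ^ k) * (\<Prod>k<N. 1 + X ^ \<beta> * p ^ k)
    = (\<Sum>j\<le>M + N. gauss_binom p j (M + N - j) * X ^ theta_exp \<alpha> \<beta> (int j - int N))"
proof (induction N)
  case 0
  show ?case
  proof (induction M)
    case (Suc M)
    let ?t = "\<lambda>j. X ^ theta_exp \<alpha> \<beta> (int j)"
    have p0: "p $ 0 = 0"
      using s by (simp add: p_def)
    have t: "?t j * (X ^ \<alpha> * p ^ M) = p ^ (M - j) * ?t (Suc j)" if "j \<le> M" for j
    proof -
      \<comment> \<open>The exponents are compared after doubling, where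
        \<open>two_theta_exp\<close> turns them into quadratic polynomials.\<close>
      have "2 * int (theta_exp \<alpha> \<beta> (int j) + \<alpha> + (\<alpha> + \<beta>) * M)
          = 2 * int ((\<alpha> + \<beta>) * (M - j) + theta_exp \<alpha> \<beta> (int (Suc j)))"
        using two_theta_exp[of \<alpha> \<beta> "int j"] two_theta_exp[of \<alpha> \<beta> "int (Suc j)"] that
        by (auto simp: algebra_simps dest!: le_Suc_ex)
      then have "theta_exp \<alpha> \<beta> (int j) + \<alpha> + (\<alpha> + \<beta>) * M
          = (\<alpha> + \<beta>) * (M - j) + theta_exp \<alpha> \<beta> (int (Suc j))"
        by (metis mult_left_cancel of_nat_eq_iff zero_neq_numeral)
      then have "X ^ (theta_exp \<alpha> \<beta> (int j) + \<alpha> + (\<alpha> + \<beta>) * M)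
          = X ^ ((\<alpha> + \<beta>) * (M - j) + theta_exp \<alpha> \<beta> (int (Suc j)))"
        by (rule arg_cong)
      then show ?thesis
        unfolding X_def p_def by (simp add: algebra_simps flip: power_mult power_add)
    qed
    have "(\<Sum>j\<le>Suc M. gauss_binom p j (Suc M - j) * ?t j)
        = (\<Sum>j\<le>M. gauss_binom p j (M - j) * (p ^ (M - j) * ?t (Suc j)))
        + (\<Sum>j\<le>M. gauss_binom p j (M - j) * ?t j)"
      by (rule sum_gauss_binom_Suc'[OF p0])
    also have "(\<Sum>j\<le>M. gauss_binom p j (M - j) * (p ^ (M - j) * ?t (Suc j)))
        = (\<Sum>j\<le>M. gauss_binom p j (M - j) * (?t j * (X ^ \<alpha> * p ^ M)))"
      by (intro sum.cong refl) (use t in simp)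
    also have "\<dots> + (\<Sum>j\<le>M. gauss_binom p j (M - j) * ?t j)
        = (\<Sum>j\<le>M. gauss_binom p j (M - j) * ?t j) * (1 + X ^ \<alpha> * p ^ M)"
      by (simp add: sum_distrib_right distrib_left mult.assoc add.commute)
    also have "\<dots> = (\<Prod>k<Suc M. 1 + X ^ \<alpha> * p ^ k)"
      using Suc by simp
    finally show ?case
      by simp
  qed (simp add: theta_exp_def)
next
  case (Suc N)
  let ?S = "M + N"
  let ?t = "\<lambda>j. X ^ theta_exp \<alpha> \<beta> (int j - int N)"
  let ?u = "\<lambda>j. X ^ theta_exp \<alpha> \<beta> (int j - int (Suc N))"
  have t: "?t j * (X ^ \<beta> * p ^ N) = p ^ j * ?u j" for j
  proof -
    have "2 * int (theta_exp \<alpha> \<beta> (int j - int N) + \<beta> + (\<alpha> + \<beta>) * N)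
        = 2 * int ((\<alpha> + \<beta>) * j + theta_exp \<alpha> \<beta> (int j - int (Suc N)))"
      using two_theta_exp[of \<alpha> \<beta> "int j - int N"] two_theta_exp[of \<alpha> \<beta> "int j - int (Suc N)"]
      by (simp add: algebra_simps)
    then have "theta_exp \<alpha> \<beta> (int j - int N) + \<beta> + (\<alpha> + \<beta>) * N
        = (\<alpha> + \<beta>) * j + theta_exp \<alpha> \<beta> (int j - int (Suc N))"
      by (metis mult_left_cancel of_nat_eq_iff zero_neq_numeral)
    then have "X ^ (theta_exp \<alpha> \<beta> (int j - int N) + \<beta> + (\<alpha> + \<beta>) * N)
        = X ^ ((\<alpha> + \<beta>) * j + theta_exp \<alpha> \<beta> (int j - int (Suc N)))"
      by (rule arg_cong)
    then show ?thesis
      unfolding X_def p_def by (simp add: algebra_simps flip: power_mult power_add)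
  qed
  have "(\<Sum>j\<le>Suc ?S. gauss_binom p j (Suc ?S - j) * ?u j)
      = (\<Sum>j\<le>?S. gauss_binom p j (?S - j) * ?t j) + (\<Sum>j\<le>?S. gauss_binom p j (?S - j) * (p ^ j * ?u j))"
    by (subst sum_gauss_binom_Suc) simp
  also have "(\<Sum>j\<le>?S. gauss_binom p j (?S - j) * (p ^ j * ?u j))
      = (\<Sum>j\<le>?S. gauss_binom p j (?S - j) * (?t j * (X ^ \<beta> * p ^ N)))"
    by (simp only: t)
  also have "(\<Sum>j\<le>?S. gauss_binom p j (?S - j) * ?t j) + \<dots>
      = (\<Sum>j\<le>?S. gauss_binom p j (?S - j) * ?t j) * (1 + X ^ \<beta> * p ^ N)"
    by (simp add: sum_distrib_right distrib_left mult.assoc)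
  also have "\<dots> = (\<Prod>k<M. 1 + X ^ \<alpha> * p ^ k) * (\<Prod>k<Suc N. 1 + X ^ \<beta> * p ^ k)"
    by (simp add: Suc.IH[symmetric] mult.assoc)
  finally show ?case
    by simp
qed

text \<open>The bilateral series \<open>\<Sum>\<^sub>n X\<^bsup>e n\<^esup>\<close>; an infinite fibre of \<open>e\<close> contributes \<open>0\<close>.\<close>

definition theta_fps :: "(int \<Rightarrow> nat) \<Rightarrow> 'a::comm_ring_1 fps" where
  "theta_fps e = Abs_fps (\<lambda>d. of_nat (card (e -` {d})))"

text \<open>Writing P for (p;p) and G for the binomial, the factorial formula gives G P P = P modulo
  the stated power, because all three finite products agree with P there. The unit P is then
  cancelled.\<close>

lemma gauss_binom_dvd_diff:
  fixes p :: "'a::field fps"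
  assumes p: "p $ 0 = 0"
  shows "fps_X ^ Suc (min m k) dvd gauss_binom p m k * fps_qpoch p p - 1"
proof -
  let ?Q = "\<lambda>n. \<Prod>i<n. 1 - p * p ^ i"
  let ?P = "fps_qpoch p p"
  let ?D = "fps_X ^ Suc (min m k) :: 'a fps"
  have Q: "?D dvd ?P - ?Q n" if "min m k \<le> n" for n
  proof (rule dvd_trans)
    show "?D dvd fps_X ^ (n + 1)"
      using that by (intro le_imp_power_dvd) simp
    show "fps_X ^ (n + 1) dvd ?P - ?Q n"
      using fps_qpoch_dvd_diff[of 1 p p n] p by (simp add: fps_X_dvd_iff)
  qed
  have "?D dvd gauss_binom p m k * ?P * ?P - gauss_binom p m k * ?Q m * ?Q k"
    by (intro dvd_diff_mult_mono Q) simp_all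
  moreover have "?D dvd ?P - gauss_binom p m k * ?Q m * ?Q k"
    unfolding gauss_binom_mult by (rule Q) simp
  ultimately have "?D dvd (gauss_binom p m k * ?P * ?P - gauss_binom p m k * ?Q m * ?Q k)
      - (?P - gauss_binom p m k * ?Q m * ?Q k)"
    by (rule dvd_diff)
  then have "?D dvd gauss_binom p m k * ?P * ?P - ?P"
    by simp
  then have "?D dvd inverse ?P * (gauss_binom p m k * ?P * ?P - ?P)"
    by (rule dvd_mult)
  moreover have "inverse ?P * ?P = 1"
    using p by (intro inverse_mult_eq_1) (simp add: fps_qpoch_nth_0)
  moreover have "inverse ?P * (gauss_binom p m k * ?P * ?P - ?P)
      = (inverse ?P * ?P) * (gauss_binom p m k * ?P - 1)"
    by (simp add: algebra_simps)
  ultimately show ?thesis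
    by simp
qed

theorem jacobi_triple_product:
  fixes \<alpha> \<beta> :: nat
  assumes s: "\<alpha> + \<beta> > 0"
  defines "p \<equiv> fps_X ^ (\<alpha> + \<beta>) :: 'a::field fps"
  shows "fps_qpoch (- (fps_X ^ \<alpha>)) p * fps_qpoch (- (fps_X ^ \<beta>)) p * fps_qpoch p p
    = theta_fps (theta_exp \<alpha> \<beta>)"
proof (rule fps_ext)
  fix d
  \<comment> \<open>This is just large enough. With e the exponent of summand j,
    \<open>theta_exp_lower\<close> gives min(j, 2N-j) = N - |j-N| >= d - e, so the error, of order
    at least min(j, 2N-j) + 1 + e, begins beyond degree \<open>d\<close>.\<close>
  define N where "N = Suc d"
  have p0: "p $ 0 = 0"
    using s by (simp add: p_def)
  let ?P = "fps_qpoch p p"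
  let ?t = "\<lambda>j. fps_X ^ theta_exp \<alpha> \<beta> (int j - int N) :: 'a fps"
  have "fps_X ^ N dvd fps_qpoch (- (fps_X ^ \<alpha>)) p * fps_qpoch (- (fps_X ^ \<beta>)) p * ?P
      - (\<Prod>k<N. 1 - - (fps_X ^ \<alpha>) * p ^ k) * (\<Prod>k<N. 1 - - (fps_X ^ \<beta>) * p ^ k) * ?P"
    using fps_qpoch_dvd_diff[of 0 "- (fps_X ^ \<alpha>)" p N] fps_qpoch_dvd_diff[of 0 "- (fps_X ^ \<beta>)" p N] p0
    by (intro dvd_diff_mult_mono) auto
  then have "(fps_qpoch (- (fps_X ^ \<alpha>)) p * fps_qpoch (- (fps_X ^ \<beta>)) p * ?P) $ d
      = ((\<Prod>k<N. 1 - - (fps_X ^ \<alpha>) * p ^ k) * (\<Prod>k<N. 1 - - (fps_X ^ \<beta>) * p ^ k) * ?P) $ d"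
    by (rule fps_X_power_dvd_nth_eq) (simp add: N_def)
  also have "(\<Prod>k<N. 1 - - (fps_X ^ \<alpha>) * p ^ k) * (\<Prod>k<N. 1 - - (fps_X ^ \<beta>) * p ^ k) * ?P
      = (\<Sum>j\<le>2 * N. gauss_binom p j (2 * N - j) * ?P * ?t j)"
    using finite_jacobi_triple_product[OF s, of N N, where 'a = 'a]
    by (simp add: p_def sum_distrib_left mult_ac flip: mult_2_right)
  also have "\<dots> $ d = (\<Sum>j\<le>2 * N. ?t j $ d)"
    unfolding fps_sum_nth
  proof (rule sum.cong[OF refl])
    fix j assume "j \<in> {..2 * N}"
    let ?e = "theta_exp \<alpha> \<beta> (int j - int N)"
    have "fps_X ^ Suc (min j (2 * N - j)) * fps_X ^ ?e dvd
        (gauss_binom p j (2 * N - j) * ?P - 1) * ?t j"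
      by (rule mult_dvd_mono[OF gauss_binom_dvd_diff[OF p0] dvd_refl])
    moreover have "d < Suc (min j (2 * N - j)) + ?e"
      using theta_exp_lower[OF s, of "int j - int N"] \<open>j \<in> _\<close> by (auto simp: N_def min_def)
    ultimately show "(gauss_binom p j (2 * N - j) * ?P * ?t j) $ d = ?t j $ d"
      by (intro fps_X_power_dvd_nth_eq[of "Suc (min j (2 * N - j)) + ?e"])
        (simp_all add: left_diff_distrib mult.assoc del: power_Suc flip: power_add)
  qed
  also have "\<dots> = of_nat (card {j \<in> {..2 * N}. theta_exp \<alpha> \<beta> (int j - int N) = d})"
    by (simp add: sum.If_cases Int_def eq_commute)
  also have "card {j \<in> {..2 * N}. theta_exp \<alpha> \<beta> (int j - int N) = d}
      = card (theta_exp \<alpha> \<beta> -` {d})"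
  proof (rule bij_betw_same_card)
    \<comment> \<open>The window of indices from -N to N contains the whole fibre over
      \<open>d\<close>.\<close>
    have *: "- int N \<le> n" "n \<le> int N" if "d = theta_exp \<alpha> \<beta> n" for n
      using theta_exp_lower[OF s, of n] that by (simp_all add: N_def)
    show "bij_betw (\<lambda>j. int j - int N)
        {j \<in> {..2 * N}. theta_exp \<alpha> \<beta> (int j - int N) = d} (theta_exp \<alpha> \<beta> -` {d})"
      by (rule bij_betwI[where g = "\<lambda>n. nat (n + int N)"]) (auto dest: *)
  qed
  finally show "(fps_qpoch (- (fps_X ^ \<alpha>)) p * fps_qpoch (- (fps_X ^ \<beta>)) p * ?P) $ d
      = theta_fps (theta_exp \<alpha> \<beta>) $ d"
    by (simp add: theta_fps_def)
qed

section \<open>Evaluating Laurent polynomials\<close>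

text \<open>A Laurent series in \<open>z\<close> cannot be evaluated in general; the relation holds for the
  Laurent polynomials and their value at \<open>z\<close>.\<close>

inductive laurent_eval :: "'a::field \<Rightarrow> 'a fls \<Rightarrow> 'a \<Rightarrow> bool" for z where
  zero: "laurent_eval z 0 0"
| step: "laurent_eval z f c \<Longrightarrow> laurent_eval z (f + fls_shift (- m) (fls_const a)) (c + a * z powi m)"

lemma laurent_eval_monom: "laurent_eval z (fls_shift (- m) (fls_const a)) (a * z powi m)"
  using laurent_eval.step[OF laurent_eval.zero, of z m a] by simp

lemma laurent_eval_const: "laurent_eval z (fls_const a) a"
  using laurent_eval_monom[of z 0 a] by simp

lemma laurent_eval_add:
  assumes "laurent_eval z f c" "laurent_eval z g d"
  shows "laurent_eval z (f + g) (c + d)"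
  using assms(2)
proof induction
  case (step g d m a)
  then show ?case
    using laurent_eval.step[OF step.IH, of m a] by (simp add: add.assoc)
qed (simp add: assms)

lemma laurent_eval_monom_mult:
  assumes "z \<noteq> 0" "laurent_eval z f c"
  shows "laurent_eval z (fls_shift (- m) (fls_const a) * f) (a * z powi m * c)"
  using assms(2)
proof induction
  case (step f c n b)
  have "fls_shift (- m) (fls_const a) * fls_shift (- n) (fls_const b)
      = fls_shift (- (m + n)) (fls_const (a * b))"
    by (simp add: fls_times_both_shifted_simp)
  then show ?case
    using laurent_eval.step[OF step.IH, of "m + n" "a * b"] assms(1)
    by (simp add: distrib_left power_int_add mult_ac)
qed (simp add: laurent_eval.zero)

lemma laurent_eval_mult:
  assumes "z \<noteq> 0" "laurent_eval z f c" "laurent_eval z g d"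
  shows "laurent_eval z (f * g) (c * d)"
  using assms(2)
proof induction
  case (step f c m a)
  then show ?case
    using laurent_eval_add[OF step.IH laurent_eval_monom_mult[OF assms(1,3), of m a]]
    by (simp add: distrib_right)
qed (simp add: laurent_eval.zero)

lemma laurent_eval_uminus:
  assumes "z \<noteq> 0" "laurent_eval z f c"
  shows "laurent_eval z (- f) (- c)"
  using laurent_eval_monom_mult[OF assms, of 0 "- 1"] by simp

lemma laurent_eval_diff:
  assumes "z \<noteq> 0" "laurent_eval z f c" "laurent_eval z g d"
  shows "laurent_eval z (f - g) (c - d)"
  using laurent_eval_add[OF assms(2) laurent_eval_uminus[OF assms(1,3)]] by simp

lemma laurent_eval_sum:
  assumes "\<And>i. i \<in> A \<Longrightarrow> laurent_eval z (f i) (c i)"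
  shows "laurent_eval z (\<Sum>i\<in>A. f i) (\<Sum>i\<in>A. c i)"
  using assms
  by (induction A rule: infinite_finite_induct) (auto intro: laurent_eval.zero laurent_eval_add)

text \<open>Connects the relation to the sum over all integers: each monomial contributes a single
  term, so the sum is genuinely convergent and \<open>infsum\<close> does not take its default
  value.\<close>

lemma laurent_eval_has_sum:
  fixes z :: "'a::{field,topological_comm_monoid_add}"
  assumes "laurent_eval z f c"
  shows "((\<lambda>m. fls_nth f m * z powi m) has_sum c) UNIV"
  using assms
proof induction
  case (step f c m a)
  have "((\<lambda>n. fls_nth (fls_shift (- m) (fls_const a)) n * z powi n) has_sum (\<Sum>n\<in>{m}. a * z powi n)) UNIV"
    by (rule has_sum_finite_neutralI[of "{m}"]) auto
  then show ?case
    using has_sum_add[OF step.IH] by (simp add: distrib_right)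
qed simp

definition laurent_eval_fps :: "'a::field \<Rightarrow> 'a fls fps \<Rightarrow> 'a fps \<Rightarrow> bool" where
  "laurent_eval_fps z f g \<longleftrightarrow> (\<forall>n. laurent_eval z (f $ n) (g $ n))"

lemma laurent_eval_fps_const:
  "laurent_eval z c d \<Longrightarrow> laurent_eval_fps z (fps_const c) (fps_const d)"
  by (auto simp: laurent_eval_fps_def laurent_eval.zero)

lemma laurent_eval_fps_X: "laurent_eval_fps z fps_X fps_X"
  using laurent_eval_const[of z 1] by (auto simp: laurent_eval_fps_def fps_X_def laurent_eval.zero)

lemma laurent_eval_fps_1: "laurent_eval_fps z 1 1"
  using laurent_eval_const[of z 1] by (auto simp: laurent_eval_fps_def laurent_eval.zero)

lemma laurent_eval_fps_diff:
  assumes "z \<noteq> 0" "laurent_eval_fps z f f'" "laurent_eval_fps z g g'"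
  shows "laurent_eval_fps z (f - g) (f' - g')"
  using assms by (auto simp: laurent_eval_fps_def intro: laurent_eval_diff)

lemma laurent_eval_fps_mult:
  assumes "z \<noteq> 0" "laurent_eval_fps z f f'" "laurent_eval_fps z g g'"
  shows "laurent_eval_fps z (f * g) (f' * g')"
  using assms by (auto simp: laurent_eval_fps_def fps_mult_nth intro!: laurent_eval_sum laurent_eval_mult)

lemma laurent_eval_fps_power:
  assumes "z \<noteq> 0" "laurent_eval_fps z f f'"
  shows "laurent_eval_fps z (f ^ k) (f' ^ k)"
proof (induction k)
  case (Suc k)
  then show ?case
    using laurent_eval_fps_mult[OF assms] by simp
qed (simp add: laurent_eval_fps_1)

lemma laurent_eval_fps_qpoch:
  assumes z: "z \<noteq> 0" and a: "laurent_eval_fps z a a'" and b: "laurent_eval_fps z b b'"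
  shows "laurent_eval_fps z (fps_qpoch a b) (fps_qpoch a' b')"
proof -
  have "laurent_eval_fps z (\<Prod>k<n. 1 - a * b ^ k) (\<Prod>k<n. 1 - a' * b' ^ k)" for n
    by (induction n) (auto intro!: z a b laurent_eval_fps_1 laurent_eval_fps_mult
        laurent_eval_fps_diff laurent_eval_fps_power)
  then show ?thesis
    by (simp add: laurent_eval_fps_def fps_qpoch_def del: prod.lessThan_Suc)
qed

text \<open>When the divisor has constant term 1, coefficient \<open>n\<close> of the quotient is
  coefficient \<open>n\<close> of the product minus terms with earlier quotient coefficients. Strong
  induction therefore makes every coefficient of the quotient a Laurent polynomial with the expected
  value.\<close>

lemma laurent_eval_fps_cancel:
  fixes f g :: "'a::field fls fps" and f' g' :: "'a fps"
  assumes z: "z \<noteq> 0" and fg: "laurent_eval_fps z (f * g) (f' * g')"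
    and g: "laurent_eval_fps z g g'" "g $ 0 = 1" "g' $ 0 = 1"
  shows "laurent_eval_fps z f f'"
proof -
  have *: "h $ n = (h * k) $ n - (\<Sum>i<n. h $ i * k $ (n - i))" if "k $ 0 = 1"
    for h k :: "'b::comm_ring_1 fps" and n
    using that by (simp add: fps_mult_nth atLeast0AtMost lessThan_Suc_atMost[symmetric])
  have "laurent_eval z (f $ n) (f' $ n)" for n
  proof (induction n rule: less_induct)
    case (less n)
    show ?case
      unfolding *[of g f n, OF g(2)] *[of g' f' n, OF g(3)]
      using fg g(1) less
      by (auto simp: laurent_eval_fps_def intro!: laurent_eval_diff laurent_eval_sum laurent_eval_mult z)
  qed
  then show ?thesis
    by (simp add: laurent_eval_fps_def)
qed


section \<open>The generating function at a nonzero number and at a cube root of unity\<close>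

lemma M2_gf_eval:
  assumes "\<zeta> \<noteq> 0"
  defines "den \<equiv> fps_qpoch (fps_const \<zeta> * fps_X ^ 2) (fps_X ^ 2)
      * fps_qpoch (fps_const (inverse \<zeta>) * fps_X ^ 2) (fps_X ^ 2)"
  shows "Abs_fps (\<lambda>n. \<Sum>\<^sub>\<infinity>m::int. M2 m n * \<zeta> powi m) * den
    = fps_qpoch (- fps_X) (fps_X ^ 2) * qp 2"
proof -
  \<comment> \<open>The same expressions at two types: primed series have Laurent series in z as
    coefficients, unprimed ones their values at \<zeta>.\<close>
  define num' :: "complex fls fps" where "num' = fps_qpoch (- fps_X) (fps_X ^ 2) * qp 2"
  define den' :: "complex fls fps" where
    "den' = fps_qpoch (fps_const fls_X * fps_X ^ 2) (fps_X ^ 2)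
        * fps_qpoch (fps_const fls_X_inv * fps_X ^ 2) (fps_X ^ 2)"
  define num :: "complex fps" where "num = fps_qpoch (- fps_X) (fps_X ^ 2) * qp 2"
  have den0: "fps_nth den 0 = 1" "fps_nth den' 0 = 1"
    by (simp_all add: den_def den'_def fps_qpoch_nth_0)
  have "laurent_eval \<zeta> fls_X \<zeta>" "laurent_eval \<zeta> fls_X_inv (inverse \<zeta>)"
    using laurent_eval_monom[of \<zeta> 1 1] laurent_eval_monom[of \<zeta> "- 1" 1]
    by (simp_all add: fls_X_conv_shift_1 fls_X_inv_conv_shift_1 power_int_minus)
  note eval = this[THEN laurent_eval_fps_const] laurent_eval_fps_X[of \<zeta>]
  have eval_den: "laurent_eval_fps \<zeta> den' den"
    unfolding den'_def den_def
    by (intro laurent_eval_fps_mult laurent_eval_fps_qpoch laurent_eval_fps_power eval assms(1))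
  have "laurent_eval_fps \<zeta> (- fps_X) (- fps_X)"
    using laurent_eval_fps_diff[OF assms(1) laurent_eval_fps_diff[OF assms(1) eval(3) eval(3)] eval(3)]
    by simp
  then have "laurent_eval_fps \<zeta> num' num"
    unfolding num'_def num_def
    by (intro laurent_eval_fps_mult laurent_eval_fps_qpoch laurent_eval_fps_power eval assms(1))
  moreover have "M2_gf * den' = num'"
    using den0(2) inverse_mult_eq_1[of den']
    by (simp add: M2_gf_def fps_divide_unit mult.assoc flip: num'_def den'_def)
  moreover have "num / den * den = num"
    using den0(1) inverse_mult_eq_1[of den] by (simp add: fps_divide_unit mult.assoc)
  ultimately have "laurent_eval_fps \<zeta> M2_gf (num / den)"
    using laurent_eval_fps_cancel[OF assms(1) _ eval_den den0(2,1)] by simp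
  then have "Abs_fps (\<lambda>n. \<Sum>\<^sub>\<infinity>m::int. M2 m n * \<zeta> powi m) = num / den"
    by (intro fps_ext) (auto simp: laurent_eval_fps_def M2_def intro!: infsumI laurent_eval_has_sum)
  then show ?thesis
    using \<open>num / den * den = num\<close> by (simp add: num_def)
qed

text \<open>Factor by factor this is 1 - y^3 = (1 - \<omega> y)(1 - y/\<omega>)(1 - y). Writing the
  inverse of \<omega> as -1 - \<omega> makes it a polynomial consequence of \<omega>^2 + \<omega> +
  1 = 0.\<close>

lemma fps_qpoch_cube_root_of_unity:
  fixes \<omega> :: "'a::field" and x p :: "'a fps"
  assumes \<omega>: "\<omega> ^ 3 = 1" "\<omega> \<noteq> 1" and p: "fps_nth p 0 = 0"
  shows "fps_qpoch (fps_const \<omega> * x) p * fps_qpoch (fps_const (inverse \<omega>) * x) p * fps_qpoch x p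
    = fps_qpoch (x ^ 3) (p ^ 3)"
proof (rule sym, rule fps_qpoch_eqI)
  have "(\<omega> - 1) * (\<omega>\<^sup>2 + \<omega> + 1) = 0"
    using \<omega>(1) by (simp add: algebra_simps power2_eq_square power3_eq_cube)
  then have w: "\<omega>\<^sup>2 + \<omega> + 1 = 0"
    using \<omega>(2) by simp
  have inv: "inverse \<omega> = - 1 - \<omega>"
  proof (rule inverse_unique)
    show "\<omega> * (- 1 - \<omega>) = 1"
      using w by (simp add: algebra_simps power2_eq_square add_eq_0_iff2)
  qed
  define c where "c = fps_const \<omega>"
  have c: "c\<^sup>2 + c + 1 = 0"
    using w by (simp add: c_def fps_const_power flip: fps_const_1_eq_1 fps_const_0_eq_0)
  have d: "fps_const (inverse \<omega>) = - 1 - c"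
    by (simp add: inv c_def flip: fps_const_1_eq_1 fps_const_sub fps_const_neg)
  fix N
  let ?Q = "\<lambda>a. \<Prod>k<N. 1 - a * p ^ k"
  have "1 - y ^ 3 = (1 - c * y) * (1 - (- 1 - c) * y) * (1 - y)" for y
    using c by algebra
  moreover have "x ^ 3 * (p ^ 3) ^ k = (x * p ^ k) ^ 3" for k
    by (simp add: power_mult_distrib mult.commute flip: power_mult)
  ultimately have "(\<Prod>k<N. 1 - x ^ 3 * (p ^ 3) ^ k)
      = (\<Prod>k<N. (1 - c * (x * p ^ k)) * (1 - (- 1 - c) * (x * p ^ k)) * (1 - x * p ^ k))"
    by (simp only:)
  also have "\<dots> = ?Q (c * x) * ?Q ((- 1 - c) * x) * ?Q x"
    by (simp add: prod.distrib mult.assoc)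
  finally have *: "(\<Prod>k<N. 1 - x ^ 3 * (p ^ 3) ^ k) = ?Q (c * x) * ?Q ((- 1 - c) * x) * ?Q x" .
  have "fps_X ^ N dvd fps_qpoch a p - ?Q a" for a
    using fps_qpoch_dvd_diff[of 0 a p N] p by simp
  then have "fps_X ^ N dvd fps_qpoch (c * x) p * fps_qpoch ((- 1 - c) * x) p * fps_qpoch x p
      - ?Q (c * x) * ?Q ((- 1 - c) * x) * ?Q x"
    by (intro dvd_diff_mult_mono)
  then show "fps_X ^ N dvd (\<Prod>k<N. 1 - x ^ 3 * (p ^ 3) ^ k)
      - fps_qpoch (fps_const \<omega> * x) p * fps_qpoch (fps_const (inverse \<omega>) * x) p * fps_qpoch x p"
    unfolding * d by (fold c_def) (metis dvd_minus_iff minus_diff_eq)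
qed (use p in simp)

section \<open>Trisection of theta series\<close>

lemma theta_fps_compose_X_power:
  assumes "k > 0"
  shows "theta_fps e oo fps_X ^ k = theta_fps (\<lambda>n. k * e n)"
proof (rule fps_ext)
  fix d
  have "(\<lambda>n. k * e n) -` {d} = (if k dvd d then e -` {d div k} else {})"
    using assms by auto
  then show "fps_nth (theta_fps e oo fps_X ^ k) d = fps_nth (theta_fps (\<lambda>n. k * e n)) d"
    by (simp add: theta_fps_def fps_nth_compose_X_power)
qed

lemma X_mult_theta_fps: "fps_X * theta_fps e = theta_fps (\<lambda>n. Suc (e n))"
proof (rule fps_ext)
  fix d
  have "(\<lambda>n. Suc (e n)) -` {d} = (if d = 0 then {} else e -` {d - 1})"
    by auto
  then show "fps_nth (fps_X * theta_fps e) d = fps_nth (theta_fps (\<lambda>n. Suc (e n))) d"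
    by (simp add: theta_fps_def)
qed

lemma theta_fps_uminus: "theta_fps (\<lambda>n. e (- n)) = theta_fps e"
proof -
  have "card ((\<lambda>n. e (- n)) -` {d}) = card (e -` {d})" for d
    by (rule bij_betw_same_card[of uminus]) (rule bij_betwI[where g = uminus], auto)
  then show ?thesis
    by (simp add: theta_fps_def)
qed

text \<open>The representatives 3n and 3n+1, 3n-1 are chosen so that reflection n -> -n pairs
  classes. Finiteness matters because \<open>card\<close> of an infinite fibre is 0 and would not be
  additive.\<close>

lemma theta_fps_trisect:
  assumes fin: "\<And>d. finite (e -` {d})"
  shows "theta_fps e = theta_fps (\<lambda>n. e (3 * n)) + theta_fps (\<lambda>n. e (3 * n + 1))
    + theta_fps (\<lambda>n. e (3 * n - 1))"
proof (rule fps_ext)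
  fix d
  let ?S = "\<lambda>r. {n \<in> e -` {d}. n mod 3 = r}"
  have S: "card ((\<lambda>n. e (3 * n + c)) -` {d}) = card (?S (c mod 3))" for c
    by (rule bij_betw_same_card[of "\<lambda>n. 3 * n + c"], rule bij_betwI[where g = "\<lambda>n. (n - c) div 3"])
      (auto simp: mod_eq_dvd_iff)
  have "e -` {d} = ?S 0 \<union> ?S 1 \<union> ?S 2"
    by auto
  then have "card (e -` {d}) = card (?S 0 \<union> ?S 1 \<union> ?S 2)"
    by (rule arg_cong)
  also have "\<dots> = card (?S 0) + card (?S 1) + card (?S 2)"
  proof -
    have "finite (?S r)" for r
      by (rule finite_subset[OF _ fin[of d]]) auto
    moreover have "?S 0 \<inter> ?S 1 = {}" "(?S 0 \<union> ?S 1) \<inter> ?S 2 = {}"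
      by auto
    ultimately show ?thesis
      by (simp only: card_Un_disjoint finite_Un)
  qed
  finally show "fps_nth (theta_fps e) d = fps_nth (theta_fps (\<lambda>n. e (3 * n))
      + theta_fps (\<lambda>n. e (3 * n + 1)) + theta_fps (\<lambda>n. e (3 * n - 1))) d"
    using S[of 0] S[of 1] S[of "- 1"] by (simp add: theta_fps_def)
qed

lemma finite_theta_exp_fibre:
  assumes "\<alpha> + \<beta> > 0"
  shows "finite (theta_exp \<alpha> \<beta> -` {d})"
proof (rule finite_subset)
  show "theta_exp \<alpha> \<beta> -` {d} \<subseteq> {- int d - 1..int d + 1}"
  proof
    fix n assume "n \<in> theta_exp \<alpha> \<beta> -` {d}"
    then show "n \<in> {- int d - 1..int d + 1}"
      using theta_exp_lower[OF assms, of n] by auto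
  qed
qed simp

lemma theta_exp_eqI:
  assumes "int \<alpha> * (n * (n + 1)) + int \<beta> * (n * (n - 1)) = 2 * int k"
  shows "theta_exp \<alpha> \<beta> n = k"
  by (simp add: theta_exp_def assms)

text \<open>The exponents are squares, and (3n+1)^2 = 1 + 3(3n^2 + 2n) with 3n^2 + 2n the exponent
  of \<open>theta_exp 5 1\<close>. The class 3n-1 gives the same series after n -> -n, whence the
  factor 2.\<close>

lemma theta_fps_square_trisect:
  fixes \<theta> :: "nat \<Rightarrow> nat \<Rightarrow> 'a::field fps"
  defines "\<theta> \<equiv> \<lambda>\<alpha> \<beta>. theta_fps (theta_exp \<alpha> \<beta>)"
  shows "\<theta> 1 1 = (\<theta> 1 1 oo fps_X ^ 9) + 2 * fps_X * (\<theta> 5 1 oo fps_X ^ 3)"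
proof -
  have 0: "theta_exp 1 1 (3 * n) = 9 * theta_exp 1 1 n" for n
    using two_theta_exp[of 1 1 n] by (intro theta_exp_eqI) (simp add: algebra_simps)
  have 1: "theta_exp 1 1 (3 * n + 1) = Suc (3 * theta_exp 5 1 n)" for n
    using two_theta_exp[of 5 1 n] by (intro theta_exp_eqI) (simp add: algebra_simps)
  have 2: "theta_exp 1 1 (3 * n - 1) = Suc (3 * theta_exp 5 1 (- n))" for n
    using two_theta_exp[of 5 1 "- n"] by (intro theta_exp_eqI) (simp add: algebra_simps)
  have "theta_fps (\<lambda>n. 3 * theta_exp 5 1 (- n)) = (theta_fps (\<lambda>n. 3 * theta_exp 5 1 n) :: 'a fps)"
    by (rule theta_fps_uminus)
  then show ?thesis
    unfolding \<theta>_def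
    by (subst theta_fps_trisect[OF finite_theta_exp_fibre])
      (simp_all add: 0 1 2 theta_fps_compose_X_power del: One_nat_def flip: X_mult_theta_fps)
qed

text \<open>Here the classes 3n and 3n-1 are the reflected pair, with exponents 3(3n^2 + n)/2 and
  3(3n^2 - n)/2; the class 3n+1 reproduces triangular numbers, as 1 + 9n(n+1)/2.\<close>

lemma theta_fps_triangular_trisect:
  fixes \<theta> :: "nat \<Rightarrow> nat \<Rightarrow> 'a::field fps"
  defines "\<theta> \<equiv> \<lambda>\<alpha> \<beta>. theta_fps (theta_exp \<alpha> \<beta>)"
  shows "\<theta> 1 0 = 2 * (\<theta> 2 1 oo fps_X ^ 3) + fps_X * (\<theta> 1 0 oo fps_X ^ 9)"
proof -
  have 0: "theta_exp 1 0 (3 * n) = 3 * theta_exp 2 1 n" for n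
    using two_theta_exp[of 2 1 n] by (intro theta_exp_eqI) (simp add: algebra_simps)
  have 1: "theta_exp 1 0 (3 * n + 1) = Suc (9 * theta_exp 1 0 n)" for n
    using two_theta_exp[of 1 0 n] by (intro theta_exp_eqI) (simp add: algebra_simps)
  have 2: "theta_exp 1 0 (3 * n - 1) = 3 * theta_exp 2 1 (- n)" for n
    using two_theta_exp[of 2 1 "- n"] by (intro theta_exp_eqI) (simp add: algebra_simps)
  have "theta_fps (\<lambda>n. 3 * theta_exp 2 1 (- n)) = (theta_fps (\<lambda>n. 3 * theta_exp 2 1 n) :: 'a fps)"
    by (rule theta_fps_uminus)
  then show ?thesis
    unfolding \<theta>_def
    by (subst theta_fps_trisect[OF finite_theta_exp_fibre])
      (simp_all add: 0 1 2 theta_fps_compose_X_power del: One_nat_def flip: X_mult_theta_fps)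
qed

section \<open>Eta quotients\<close>

lemma qp_compose_X_power:
  assumes "j > 0" "k > 0"
  shows "(qp j :: 'a::idom fps) oo fps_X ^ k = qp (j * k)"
  using assms by (simp add: fps_qpoch_compose fps_X_power_compose mult.commute flip: power_mult)

lemma qp_nth_0: "j > 0 \<Longrightarrow> fps_nth (qp j) 0 = 1"
  by (simp add: fps_qpoch_nth_0)

lemma qp_nonzero: "j > 0 \<Longrightarrow> qp j \<noteq> (0 :: 'a::idom fps)"
  using qp_nth_0[of j, where 'a = 'a] by (metis fps_zero_nth zero_neq_one)

lemma fps_qpoch_first:
  fixes a b :: "'a::comm_ring_1 fps"
  assumes b: "fps_nth b 0 = 0"
  shows "fps_qpoch a b = (1 - a) * fps_qpoch (a * b) b"
proof (rule fps_qpoch_eqI[OF b])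
  fix N
  have "fps_X ^ N dvd fps_qpoch (a * b) b - (\<Prod>k<N. 1 - a * b * b ^ k)"
    using fps_qpoch_dvd_diff[of 0 "a * b" b N] b by simp
  then have "fps_X ^ N dvd (1 - a) * fps_qpoch (a * b) b - (1 - a) * (\<Prod>k<N. 1 - a * b * b ^ k)"
    by (intro dvd_diff_mult_mono) simp_all
  moreover have "(1 - a) * (\<Prod>k<N. 1 - a * b * b ^ k) = (\<Prod>k<Suc N. 1 - a * b ^ k)"
    by (subst prod.lessThan_Suc_shift) (simp add: mult.assoc)
  moreover have "fps_X ^ N dvd (\<Prod>k<Suc N. 1 - a * b ^ k) - (\<Prod>k<N. 1 - a * b ^ k)"
    using prod_qpoch_dvd_diff[of 0 a b N "Suc N"] b by simp
  ultimately have "fps_X ^ N dvd ((1 - a) * fps_qpoch (a * b) b - (\<Prod>k<Suc N. 1 - a * b ^ k))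
      + ((\<Prod>k<Suc N. 1 - a * b ^ k) - (\<Prod>k<N. 1 - a * b ^ k))"
    by (metis dvd_add)
  then show "fps_X ^ N dvd (\<Prod>k<N. 1 - a * b ^ k) - (1 - a) * fps_qpoch (a * b) b"
    by (metis (no_types, lifting) add_diff_cancel_right' diff_add_cancel add_diff_eq dvd_minus_iff minus_diff_eq)
qed

lemma qpoch_uminus_X:
  "fps_qpoch (- fps_X) fps_X * qp 1 = (qp 2 :: 'a::idom fps)"
  using fps_qpoch_mult_uminus[of fps_X "fps_X :: 'a fps"] by simp

lemma qpoch_uminus_X_square:
  "fps_qpoch (- fps_X) (fps_X ^ 2) * qp 1 * qp 4 = (qp 2 ^ 2 :: 'a::idom fps)"
proof -
  have 1: "fps_qpoch (- fps_X) (fps_X ^ 2) * fps_qpoch fps_X (fps_X ^ 2)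
      = (fps_qpoch (fps_X ^ 2) (fps_X ^ 4) :: 'a fps)"
    using fps_qpoch_mult_uminus[of "fps_X ^ 2" "fps_X :: 'a fps"] by (simp flip: power_mult)
  have 2: "fps_qpoch fps_X (fps_X ^ 2) * qp 2 = (qp 1 :: 'a fps)"
    using fps_qpoch_split[of fps_X 2 "fps_X :: 'a fps"]
    by (simp add: numeral_2_eq_2 flip: power_Suc)
  have 3: "fps_qpoch (fps_X ^ 2) (fps_X ^ 4) * qp 4 = (qp 2 :: 'a fps)"
    using fps_qpoch_split[of "fps_X ^ 2" 2 "fps_X ^ 2 :: 'a fps"]
    by (simp add: numeral_eq_Suc flip: power_mult power_add power_Suc)
  \<comment> \<open>The elimination is done with letters for the infinite products:
    \<open>a\<close>, \<open>b\<close>, \<open>d\<close> stand for \<open>qp 1\<close>,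
    \<open>qp 2\<close>, \<open>qp 4\<close>. The later product formulas use the same
    device.\<close>
  have "P * a * d = b ^ 2" if "P * Q = R" "Q * b = a" "R * d = b" for P Q R a b d :: "'a fps"
    using that by (auto simp: power2_eq_square mult_ac)
  from this[OF 1 2 3] show ?thesis .
qed


lemma theta_square_product:
  "theta_fps (theta_exp 1 1) * qp 1 ^ 2 * qp 4 ^ 2 = (qp 2 ^ 5 :: 'a::field fps)"
proof -
  have "fps_qpoch (- fps_X) (fps_X ^ 2) ^ 2 * qp 2 = (theta_fps (theta_exp 1 1) :: 'a fps)"
    using jacobi_triple_product[of 1 1, where 'a = 'a] by (simp add: power2_eq_square del: One_nat_def)
  moreover have "t * a ^ 2 * d ^ 2 = b ^ 5" if "P ^ 2 * b = t" "P * a * d = b ^ 2"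
    for P a b d t :: "'a fps"
  proof -
    have "t * a ^ 2 * d ^ 2 = (P * a * d) ^ 2 * b"
      by (simp add: that(1)[symmetric] power_mult_distrib mult_ac)
    then show ?thesis
      by (simp add: that(2) flip: power_mult power_Suc2)
  qed
  ultimately show ?thesis
    using qpoch_uminus_X_square by blast
qed

lemma theta_triangular_product:
  "theta_fps (theta_exp 1 0) * qp 1 = (2 * qp 2 ^ 2 :: 'a::field fps)"
proof -
  have "fps_qpoch (- fps_X) fps_X * fps_qpoch (- 1) fps_X * qp 1 = (theta_fps (theta_exp 1 0) :: 'a fps)"
    using jacobi_triple_product[of 1 0, where 'a = 'a] by (simp del: One_nat_def)
  \<comment> \<open>The first factor of (-1;q) is 1 + 1, which accounts for the 2 in 2 psi.\<close>
  moreover have "fps_qpoch (- 1) fps_X = (2 * fps_qpoch (- fps_X) fps_X :: 'a fps)"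
    by (subst fps_qpoch_first) simp_all
  moreover have "t * a = 2 * b ^ 2" if "P * Q * a = t" "Q = 2 * P" "P * a = b" for P Q a b t :: "'a fps"
    using that by (auto simp: power2_eq_square mult_ac)
  ultimately show ?thesis
    using qpoch_uminus_X by blast
qed

text \<open>The triple product has the factors (-q;q^3) and (-q^2;q^3), which (-q^3;q^3) completes
  to (-q;q).\<close>

lemma theta_2_1_product:
  "theta_fps (theta_exp 2 1) * (qp 1 * qp 6) = (qp 2 * qp 3 ^ 2 :: 'a::field fps)"
proof -
  let ?P = "\<lambda>i. fps_qpoch (- (fps_X ^ i)) (fps_X ^ 3) :: 'a fps"
  have 1: "?P 2 * ?P 1 * qp 3 = theta_fps (theta_exp 2 1)"
    using jacobi_triple_product[of 2 1, where 'a = 'a] by (simp del: One_nat_def)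
  have 2: "?P 1 * ?P 2 * ?P 3 = fps_qpoch (- fps_X) fps_X"
    using fps_qpoch_split[of fps_X 3 "- fps_X :: 'a fps"] by (simp add: numeral_eq_Suc)
  have 3: "?P 3 * qp 3 = qp 6"
    using fps_qpoch_mult_uminus[of "fps_X ^ 3" "fps_X ^ 3 :: 'a fps"] by (simp flip: power_mult)
  have "t * (a * f) = b * c ^ 2" if "P2 * P1 * c = t" "P1 * P2 * P3 = P" "P3 * c = f" "P * a = b"
    for P P1 P2 P3 a b c f t :: "'a fps"
    using that by (auto simp: power2_eq_square mult_ac)
  from this[OF 1 2 3 qpoch_uminus_X] show ?thesis .
qed

text \<open>The factors (-q;q^6) and (-q^5;q^6) lack only (-q^3;q^6) to make up (-q;q^2); the
  missing factor is known from \<open>qpoch_uminus_X_square\<close> at q^3.\<close>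

lemma theta_5_1_product:
  "theta_fps (theta_exp 5 1) * (qp 1 * qp 4 * qp 6) = (qp 2 ^ 2 * qp 3 * qp 12 :: 'a::field fps)"
proof -
  let ?P = "\<lambda>i. fps_qpoch (- (fps_X ^ i)) (fps_X ^ 6) :: 'a fps"
  have 1: "?P 5 * ?P 1 * qp 6 = theta_fps (theta_exp 5 1)"
    using jacobi_triple_product[of 5 1, where 'a = 'a] by (simp del: One_nat_def)
  have 2: "?P 1 * ?P 3 * ?P 5 = fps_qpoch (- fps_X) (fps_X ^ 2)"
    using fps_qpoch_split[of "fps_X ^ 2" 3 "- fps_X :: 'a fps"]
    by (simp add: numeral_eq_Suc mult_ac)
  have "(fps_qpoch (- fps_X) (fps_X ^ 2) * qp 1 * qp 4) oo fps_X ^ 3 = ((qp 2 ^ 2) oo fps_X ^ 3 :: 'a fps)"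
    by (simp only: qpoch_uminus_X_square)
  then have 3: "?P 3 * qp 3 * qp 12 = qp 6 ^ 2"
    by (simp add: fps_compose_mult_distrib qp_compose_X_power fps_qpoch_compose
        fps_compose_uminus fps_X_power_compose flip: fps_compose_power power_mult)
  have "t * (a * d * f) * f = b ^ 2 * c * g * f"
    if "P5 * P1 * f = t" "P1 * P3 * P5 = P" "P3 * c * g = f ^ 2" "P * a * d = b ^ 2"
    for P P1 P3 P5 a b c d f g t :: "'a fps"
  proof -
    have "t * (a * d * f) * f = P5 * P1 * a * d * f ^ 2 * f"
      by (simp add: that(1)[symmetric] power2_eq_square mult_ac)
    also have "\<dots> = P * a * d * (c * g * f)"
      by (simp add: that(2,3)[symmetric] mult_ac)
    also have "\<dots> = b ^ 2 * c * g * f"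
      by (simp only: that(4)[symmetric] mult_ac)
    finally show ?thesis .
  qed
  from this[OF 1 2 3 qpoch_uminus_X_square] show ?thesis
    using qp_nonzero[of 6, where 'a = 'a] by simp
qed

section \<open>Substituting -q and powers of q\<close>

lemma qp_compose_uminus_X_even:
  assumes "even j" "j > 0"
  shows "(qp j :: 'a::idom fps) oo - fps_X = qp j"
  using assms by (simp add: fps_qpoch_compose fps_X_power_compose)

text \<open>With x = q^j the left factor is (-x;-x), which splits by parity of the index into
  (-x;x^2) and (x^2;x^2).\<close>

lemma qp_compose_uminus_X_odd:
  assumes "odd j"
  shows "(qp j oo - fps_X) * qp j * qp (4 * j) = (qp (2 * j) ^ 3 :: 'a::idom fps)"
proof -
  have "j > 0"
    using assms by (rule odd_pos)
  let ?x = "fps_X ^ j :: 'a fps"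
  have x: "fps_nth ?x 0 = 0"
    using \<open>j > 0\<close> by simp
  have "qp j oo - fps_X = fps_qpoch (- ?x) (- ?x)"
    using assms x by (simp add: fps_qpoch_compose fps_X_power_compose)
  also have "\<dots> = fps_qpoch (- ?x) (?x ^ 2) * fps_qpoch (?x ^ 2) (?x ^ 2)"
    using fps_qpoch_split[of "- ?x" 2 "- ?x"] x by (simp add: lessThan_Suc numeral_2_eq_2 mult.commute)
  also have "?x ^ 2 = fps_X ^ (2 * j)"
    by (simp add: mult.commute flip: power_mult)
  finally have 1: "qp j oo - fps_X = fps_qpoch (- ?x) (fps_X ^ (2 * j)) * qp (2 * j)" .
  have "(fps_qpoch (- fps_X) (fps_X ^ 2) * qp 1 * qp 4) oo ?x = (qp 2 ^ 2) oo ?x"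
    by (simp only: qpoch_uminus_X_square)
  then have 2: "fps_qpoch (- ?x) (fps_X ^ (2 * j)) * qp j * qp (4 * j) = qp (2 * j) ^ 2"
    using \<open>j > 0\<close> by (simp add: fps_compose_mult_distrib qp_compose_X_power
        fps_qpoch_compose fps_compose_uminus fps_X_power_compose mult.commute flip: fps_compose_power power_mult)
  show ?thesis
    unfolding 1 using 2 by (simp add: power2_eq_square power3_eq_cube mult_ac)
qed

lemma fps_compose_X_power_mult:
  fixes f :: "'a::idom fps"
  assumes "i > 0" "j > 0"
  shows "f oo fps_X ^ i oo fps_X ^ j = f oo fps_X ^ (i * j)"
  using assms by (simp add: fps_X_power_compose mult.commute flip: fps_compose_assoc power_mult)

lemma fps_compose_X_power_uminus_X:
  fixes f :: "'a::idom fps"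
  assumes "odd k"
  shows "f oo fps_X ^ k oo - fps_X = f oo - fps_X oo fps_X ^ k"
proof -
  have "k > 0"
    using assms by (rule odd_pos)
  then show ?thesis
    using assms by (simp add: fps_X_power_compose fps_compose_uminus flip: fps_compose_assoc)
qed

text \<open>Only the coefficients of degree \<open>3 * n\<close> are compared, since only the
  component in Z[[q^3]] has to be transferred between the two factorisations.\<close>

lemma fps_trisection_unique:
  fixes f0 f1 f2 g0 g1 g2 :: "'a::comm_ring_1 fps"
  assumes "(f0 oo fps_X ^ 3) + fps_X * (f1 oo fps_X ^ 3) + fps_X ^ 2 * (f2 oo fps_X ^ 3)
    = (g0 oo fps_X ^ 3) + fps_X * (g1 oo fps_X ^ 3) + fps_X ^ 2 * (g2 oo fps_X ^ 3)"
  shows "f0 = g0"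
proof (rule fps_ext)
  fix n
  have "fps_nth ((a oo fps_X ^ 3) + fps_X * (b oo fps_X ^ 3) + fps_X ^ 2 * (c oo fps_X ^ 3)) (3 * n)
      = fps_nth a n" for a b c :: "'a fps"
  proof (cases n)
    case (Suc m)
    then have "\<not> 3 dvd 3 * n - 1" "\<not> 3 dvd 3 * n - 2" "\<not> 3 * n < 2"
      by presburger+
    then show ?thesis
      by (simp add: fps_nth_compose_X_power fps_X_power_mult_nth del: One_nat_def)
  qed (simp add: fps_nth_compose_X_power fps_X_power_mult_nth)
  then show "fps_nth f0 n = fps_nth g0 n"
    using arg_cong[OF assms, of "\<lambda>f. fps_nth f (3 * n)"] by simp
qed

text \<open>Laurent series in q form a field, so eta quotients become fractions open to
  \<open>field_simps\<close>; the embedding is injective, so identities can be pulled back.\<close>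

definition eta_fls :: "nat \<Rightarrow> complex fls" where
  "eta_fls j = fps_to_fls (qp j)"

lemma eta_fls_nonzero: "j > 0 \<Longrightarrow> eta_fls j \<noteq> 0"
  by (simp add: eta_fls_def qp_nonzero)

lemma fps_to_fls_qp_compose:
  "j > 0 \<Longrightarrow> k > 0 \<Longrightarrow> fps_to_fls (qp j oo fps_X ^ k) = eta_fls (j * k)"
  by (simp add: eta_fls_def qp_compose_X_power)

lemma fps_to_fls_qp_uminus_X_odd:
  assumes "odd j"
  shows "fps_to_fls (qp j oo - fps_X) = eta_fls (2 * j) ^ 3 / (eta_fls j * eta_fls (4 * j))"
proof -
  have "fps_to_fls (qp j oo - fps_X) * (eta_fls j * eta_fls (4 * j)) = eta_fls (2 * j) ^ 3"
    using qp_compose_uminus_X_odd[OF assms, where 'a = complex, THEN arg_cong[of _ _ fps_to_fls]]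
    by (simp only: eta_fls_def fls_times_fps_to_fls fps_to_fls_power mult.assoc)
  then show ?thesis
    using odd_pos[OF assms] by (simp add: eta_fls_nonzero eq_divide_eq)
qed

lemma fps_to_fls_qp_uminus_X:
  "fps_to_fls (qp 1 oo - fps_X) = eta_fls 2 ^ 3 / (eta_fls 1 * eta_fls 4)"
  "fps_to_fls (qp 3 oo - fps_X) = eta_fls 6 ^ 3 / (eta_fls 3 * eta_fls 12)"
  using fps_to_fls_qp_uminus_X_odd[of 1] fps_to_fls_qp_uminus_X_odd[of 3]
  by (simp_all del: One_nat_def power_one_right)

lemmas fls_hom = fls_times_fps_to_fls fps_to_fls_power fps_to_fls_numeral

abbreviation theta :: "nat \<Rightarrow> nat \<Rightarrow> complex fps" where
  "theta \<alpha> \<beta> \<equiv> theta_fps (theta_exp \<alpha> \<beta>)"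

lemmas compose_hom = fps_compose_mult_distrib fps_compose_power[symmetric]

lemma X_power_nth_0: "k > 0 \<Longrightarrow> fps_nth (fps_X ^ k) 0 = (0 :: complex)"
  by simp

lemma uminus_X_nth_0: "fps_nth (- fps_X) 0 = (0 :: complex)"
  by simp

lemma theta_compose_X_power:
  assumes k: "k > 0"
  shows "fps_to_fls (theta 1 1 oo fps_X ^ k) = eta_fls (2 * k) ^ 5 / (eta_fls k ^ 2 * eta_fls (4 * k) ^ 2)"
    and "fps_to_fls (theta 1 0 oo fps_X ^ k) = 2 * eta_fls (2 * k) ^ 2 / eta_fls k"
    and "fps_to_fls (theta 2 1 oo fps_X ^ k)
      = eta_fls (2 * k) * eta_fls (3 * k) ^ 2 / (eta_fls k * eta_fls (6 * k))"
proof -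
  note h = arg_cong[of _ _ "\<lambda>f. fps_to_fls (f oo fps_X ^ k)"]
  note simps = compose_hom[OF X_power_nth_0[OF k]] numeral_compose fls_hom
    fps_to_fls_qp_compose[OF zero_less_numeral k] fps_to_fls_qp_compose[OF zero_less_one k] mult_1_left
  show "fps_to_fls (theta 1 1 oo fps_X ^ k) = eta_fls (2 * k) ^ 5 / (eta_fls k ^ 2 * eta_fls (4 * k) ^ 2)"
    using theta_square_product[where 'a = complex, THEN h, unfolded simps] k
    by (simp add: eta_fls_nonzero field_simps del: One_nat_def)
  show "fps_to_fls (theta 1 0 oo fps_X ^ k) = 2 * eta_fls (2 * k) ^ 2 / eta_fls k"
    using theta_triangular_product[where 'a = complex, THEN h, unfolded simps] k
    by (simp add: eta_fls_nonzero field_simps del: One_nat_def)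
  show "fps_to_fls (theta 2 1 oo fps_X ^ k)
      = eta_fls (2 * k) * eta_fls (3 * k) ^ 2 / (eta_fls k * eta_fls (6 * k))"
    using theta_2_1_product[where 'a = complex, THEN h, unfolded simps] k
    by (simp add: eta_fls_nonzero field_simps del: One_nat_def)
qed

text \<open>Replacing \<open>q\<close> by \<open>-q\<close> turns \<open>(q\<^sup>j; q\<^sup>j)\<close> with odd \<open>j\<close> into an eta quotient; these are the
  resulting forms of the four theta products, with \<open>a, b, c, d, f, g\<close> standing for
  \<open>(q\<^sup>j; q\<^sup>j)\<close> with \<open>j = 1, 2, 3, 4, 6, 12\<close>.\<close>

lemma signed_product_cancel:
  fixes t a b c d f g :: "'a::field"
  assumes nz: "a \<noteq> 0" "b \<noteq> 0" "c \<noteq> 0" "d \<noteq> 0" "f \<noteq> 0" "g \<noteq> 0"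
  shows "t * (b ^ 3 / (a * d)) ^ 2 * d ^ 2 = b ^ 5 \<Longrightarrow> t * b = a ^ 2"
    and "t * (b ^ 3 / (a * d)) = 2 * b ^ 2 \<Longrightarrow> t * b = 2 * a * d"
    and "t * (b ^ 3 / (a * d) * f) = b * (f ^ 3 / (c * g)) ^ 2 \<Longrightarrow> t * (b ^ 2 * c ^ 2 * g ^ 2) = a * d * f ^ 5"
    and "t * (b ^ 3 / (a * d) * d * f) = b ^ 2 * (f ^ 3 / (c * g)) * g \<Longrightarrow> t * (b * c) = a * f ^ 2"
proof -
  show "t * b = a ^ 2" if "t * (b ^ 3 / (a * d)) ^ 2 * d ^ 2 = b ^ 5"
  proof -
    \<comment> \<open>Clearing denominators in the hypothesis yields the claim times a monomial,
      here \<open>b ^ 5\<close>; the other three cases differ only in that monomial.\<close>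
    have "b ^ 5 * (t * b) = b ^ 5 * a ^ 2"
      using that nz by (simp add: field_simps) algebra
    then show ?thesis using nz by simp
  qed
  show "t * b = 2 * a * d" if "t * (b ^ 3 / (a * d)) = 2 * b ^ 2"
  proof -
    have "b ^ 2 * (t * b) = b ^ 2 * (2 * a * d)"
      using that nz by (simp add: field_simps) algebra
    then show ?thesis using nz by simp
  qed
  show "t * (b ^ 2 * c ^ 2 * g ^ 2) = a * d * f ^ 5" if "t * (b ^ 3 / (a * d) * f) = b * (f ^ 3 / (c * g)) ^ 2"
  proof -
    have "b * f * (t * (b ^ 2 * c ^ 2 * g ^ 2)) = b * f * (a * d * f ^ 5)"
      using that nz by (simp add: field_simps) algebra
    then show ?thesis using nz by simp
  qed
  show "t * (b * c) = a * f ^ 2" if "t * (b ^ 3 / (a * d) * d * f) = b ^ 2 * (f ^ 3 / (c * g)) * g"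
  proof -
    have "b ^ 2 * f * (t * (b * c)) = b ^ 2 * f * (a * f ^ 2)"
      using that nz by (simp add: field_simps) algebra
    then show ?thesis using nz by simp
  qed
qed

abbreviation signed_theta :: "nat \<Rightarrow> nat \<Rightarrow> complex fps" where
  "signed_theta \<alpha> \<beta> \<equiv> theta \<alpha> \<beta> oo - fps_X"

lemma signed_theta_product:
  shows "signed_theta 1 1 * qp 2 = qp 1 ^ 2"
    and "signed_theta 1 0 * qp 2 = 2 * qp 1 * qp 4"
    and "signed_theta 2 1 * (qp 2 ^ 2 * qp 3 ^ 2 * qp 12 ^ 2) = qp 1 * qp 4 * qp 6 ^ 5"
    and "signed_theta 5 1 * (qp 2 * qp 3) = qp 1 * qp 6 ^ 2"
proof -
  note h = arg_cong[of _ _ "\<lambda>f. fps_to_fls (f oo - fps_X)"]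
  have even: "(qp (numeral n) :: complex fps) oo - fps_X = qp (numeral n)" if "even (numeral n :: nat)" for n
    using qp_compose_uminus_X_even[OF that] by simp
  note simps = compose_hom[OF uminus_X_nth_0] numeral_compose fls_hom even[OF even_numeral]
    fps_to_fls_qp_uminus_X eta_fls_def[symmetric]
  note fls_eq = fps_to_fls_eq_iff[symmetric]
  show "signed_theta 1 1 * qp 2 = qp 1 ^ 2"
    using theta_square_product[where 'a = complex, THEN h, unfolded simps]
    unfolding fls_eq fls_hom eta_fls_def[symmetric]
    by (rule signed_product_cancel(1)[where c = 1 and f = 1 and g = 1, rotated -1]) (simp_all add: eta_fls_nonzero)
  show "signed_theta 1 0 * qp 2 = 2 * qp 1 * qp 4"
    using theta_triangular_product[where 'a = complex, THEN h, unfolded simps]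
    unfolding fls_eq fls_hom eta_fls_def[symmetric]
    by (rule signed_product_cancel(2)[where c = 1 and f = 1 and g = 1, rotated -1]) (simp_all add: eta_fls_nonzero)
  show "signed_theta 2 1 * (qp 2 ^ 2 * qp 3 ^ 2 * qp 12 ^ 2) = qp 1 * qp 4 * qp 6 ^ 5"
    using theta_2_1_product[where 'a = complex, THEN h, unfolded simps]
    unfolding fls_eq fls_hom eta_fls_def[symmetric]
    by (rule signed_product_cancel(3)[rotated -1]) (simp_all add: eta_fls_nonzero)
  show "signed_theta 5 1 * (qp 2 * qp 3) = qp 1 * qp 6 ^ 2"
    using theta_5_1_product[where 'a = complex, THEN h, unfolded simps]
    unfolding fls_eq fls_hom eta_fls_def[symmetric]
    by (rule signed_product_cancel(4)[rotated -1]) (simp_all add: eta_fls_nonzero)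
qed


lemma signed_theta_compose_X_power:
  assumes k: "k > 0"
  shows "fps_to_fls (signed_theta 1 1 oo fps_X ^ k) = eta_fls k ^ 2 / eta_fls (2 * k)"
    and "fps_to_fls (signed_theta 5 1 oo fps_X ^ k)
      = eta_fls k * eta_fls (6 * k) ^ 2 / (eta_fls (2 * k) * eta_fls (3 * k))"
proof -
  note h = arg_cong[of _ _ "\<lambda>f. fps_to_fls (f oo fps_X ^ k)"]
  note simps = compose_hom[OF X_power_nth_0[OF k]] numeral_compose fls_hom
    fps_to_fls_qp_compose[OF zero_less_numeral k] fps_to_fls_qp_compose[OF zero_less_one k] mult_1_left
  show "fps_to_fls (signed_theta 1 1 oo fps_X ^ k) = eta_fls k ^ 2 / eta_fls (2 * k)"
    using signed_theta_product(1)[THEN h, unfolded simps] k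
    by (simp add: eta_fls_nonzero field_simps del: One_nat_def)
  show "fps_to_fls (signed_theta 5 1 oo fps_X ^ k)
      = eta_fls k * eta_fls (6 * k) ^ 2 / (eta_fls (2 * k) * eta_fls (3 * k))"
    using signed_theta_product(4)[THEN h, unfolded simps] k
    by (simp add: eta_fls_nonzero field_simps del: One_nat_def)
qed

lemma fps_to_fls_theta:
  "fps_to_fls (theta 1 1) = eta_fls 2 ^ 5 / (eta_fls 1 ^ 2 * eta_fls 4 ^ 2)"
  "fps_to_fls (theta 1 0) = 2 * eta_fls 2 ^ 2 / eta_fls 1"
  "fps_to_fls (theta 2 1) = eta_fls 2 * eta_fls 3 ^ 2 / (eta_fls 1 * eta_fls 6)"
  using theta_compose_X_power[of 1] by (simp_all del: One_nat_def)

lemma fps_to_fls_signed_theta: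
  "fps_to_fls (signed_theta 1 0) = 2 * eta_fls 1 * eta_fls 4 / eta_fls 2"
  "fps_to_fls (signed_theta 2 1)
    = eta_fls 1 * eta_fls 4 * eta_fls 6 ^ 5 / (eta_fls 2 ^ 2 * eta_fls 3 ^ 2 * eta_fls 12 ^ 2)"
  using signed_theta_product(2,3)[THEN arg_cong[of _ _ fps_to_fls], unfolded fls_hom eta_fls_def[symmetric]]
  by (simp_all add: eta_fls_nonzero eq_divide_eq mult.assoc del: One_nat_def)

text \<open>The substitution of -q commutes with the odd powers 9 and 3 and only flips the sign of
  the isolated factor \<open>fps_X\<close>.\<close>

lemma signed_theta_trisect:
  shows "signed_theta 1 1 = (signed_theta 1 1 oo fps_X ^ 9) - 2 * fps_X * (signed_theta 5 1 oo fps_X ^ 3)"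
    and "signed_theta 1 0 = 2 * (signed_theta 2 1 oo fps_X ^ 3) - fps_X * (signed_theta 1 0 oo fps_X ^ 9)"
proof -
  note h = arg_cong[of _ _ "\<lambda>f. f oo - fps_X"]
  note simps = fps_compose_add_distrib fps_compose_mult_distrib[OF uminus_X_nth_0] numeral_compose
    fps_compose_X_power_uminus_X[OF odd_numeral] fps_X_fps_compose_startby0[OF uminus_X_nth_0]
  show "signed_theta 1 1 = (signed_theta 1 1 oo fps_X ^ 9) - 2 * fps_X * (signed_theta 5 1 oo fps_X ^ 3)"
    using theta_fps_square_trisect[where 'a = complex, THEN h, unfolded simps] by simp
  show "signed_theta 1 0 = 2 * (signed_theta 2 1 oo fps_X ^ 3) - fps_X * (signed_theta 1 0 oo fps_X ^ 9)"
    using theta_fps_triangular_trisect[where 'a = complex, THEN h, unfolded simps] by simp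
qed


section \<open>The three target quotients and the two factorisations\<close>

lemma fps_to_fls_divide:
  fixes f g :: "'a::field fps"
  assumes "fps_nth g 0 = 1"
  shows "fps_to_fls (f / g) = fps_to_fls f / fps_to_fls g"
proof -
  have "subdegree g = 0"
    using assms by (simp add: subdegree_eq_0_iff)
  then show ?thesis
    by (simp add: fls_divide_fps_to_fls)
qed

lemma fps_to_fls_M2:
  "fps_to_fls M2_03 = eta_fls 6 ^ 10 * eta_fls 4 * eta_fls 1 / (eta_fls 12 ^ 4 * eta_fls 3 ^ 4 * eta_fls 2 ^ 3)"
  "fps_to_fls M2_13 = eta_fls 6 ^ 4 / (eta_fls 12 * eta_fls 3 * eta_fls 2)"
  "fps_to_fls M2_23 = - 2 * (eta_fls 12 ^ 2 * eta_fls 3 ^ 2 * eta_fls 2) / (eta_fls 6 ^ 2 * eta_fls 4 * eta_fls 1)"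
  unfolding M2_03_def M2_13_def M2_23_def eta_fls_def
  by (simp_all add: fps_to_fls_divide fps_qpoch_nth_0 fps_nth_power_0 fls_hom del: One_nat_def power_one_right)

text \<open>The right-hand sides are, with q^3 renamed q, the unique products in their residue
  classes: 0+0 from phi(q) psi(-q), and 1+0 and 0+2 from psi(q) phi(-q^2). The factor
  \<open>qp 2\<close> becomes the (q^6;q^6) of the generating function.\<close>

lemma M2_components:
  "M2_03 * qp 2 = (theta 1 1 oo fps_X ^ 3) * signed_theta 2 1"
  "2 * M2_13 * qp 2 = (theta 1 0 oo fps_X ^ 3) * (signed_theta 1 1 oo fps_X ^ 6)"
  "M2_23 * qp 2 = - 2 * theta 2 1 * (signed_theta 5 1 oo fps_X ^ 2)"
proof -
  note fls_eq = fps_to_fls_eq_iff[symmetric]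
  have nz: "eta_fls 1 \<noteq> 0" "eta_fls 2 \<noteq> 0" "eta_fls 3 \<noteq> 0" "eta_fls 4 \<noteq> 0" "eta_fls 6 \<noteq> 0" "eta_fls 12 \<noteq> 0"
    by (simp_all add: eta_fls_nonzero)
  have e: "fps_to_fls (theta 1 1 oo fps_X ^ 3) = eta_fls 6 ^ 5 / (eta_fls 3 ^ 2 * eta_fls 12 ^ 2)"
    "fps_to_fls (theta 1 0 oo fps_X ^ 3) = 2 * eta_fls 6 ^ 2 / eta_fls 3"
    "fps_to_fls (signed_theta 1 1 oo fps_X ^ 6) = eta_fls 6 ^ 2 / eta_fls 12"
    "fps_to_fls (signed_theta 5 1 oo fps_X ^ 2) = eta_fls 2 * eta_fls 12 ^ 2 / (eta_fls 4 * eta_fls 6)"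
    using theta_compose_X_power[of 3] signed_theta_compose_X_power(1)[of 6] signed_theta_compose_X_power(2)[of 2]
    by (simp_all del: One_nat_def)
  show "M2_03 * qp 2 = (theta 1 1 oo fps_X ^ 3) * signed_theta 2 1"
    unfolding fls_eq fls_hom e fps_to_fls_M2 fps_to_fls_signed_theta eta_fls_def[symmetric]
    using nz by (simp add: divide_simps del: One_nat_def) algebra
  show "2 * M2_13 * qp 2 = (theta 1 0 oo fps_X ^ 3) * (signed_theta 1 1 oo fps_X ^ 6)"
    unfolding fls_eq fls_hom e fps_to_fls_M2 eta_fls_def[symmetric]
    using nz by (simp add: divide_simps del: One_nat_def)
  show "M2_23 * qp 2 = - 2 * theta 2 1 * (signed_theta 5 1 oo fps_X ^ 2)"
    unfolding fls_eq fls_hom e fps_to_fls_M2 fps_to_fls_theta eta_fls_def[symmetric]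
    using nz by (simp add: divide_simps fps_to_fls_theta del: One_nat_def) algebra
qed

lemma theta_product:
  fixes H :: "complex fps"
  defines "H \<equiv> fps_qpoch (- fps_X) (fps_X ^ 2) * qp 2 ^ 2"
  shows "theta 1 0 * (signed_theta 1 1 oo fps_X ^ 2) = 2 * H"
    and "theta 1 1 * signed_theta 1 0 = 2 * H"
proof -
  note fls_eq = fps_to_fls_eq_iff[symmetric]
  have nz: "eta_fls 1 \<noteq> 0" "eta_fls 2 \<noteq> 0" "eta_fls 4 \<noteq> 0"
    by (simp_all add: eta_fls_nonzero)
  have "fps_to_fls (fps_qpoch (- fps_X) (fps_X ^ 2)) * eta_fls 1 * eta_fls 4 = eta_fls 2 ^ 2"
    using qpoch_uminus_X_square[where 'a = complex, THEN arg_cong[of _ _ fps_to_fls]]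
    by (simp only: fls_hom eta_fls_def)
  then have P: "fps_to_fls (fps_qpoch (- fps_X) (fps_X ^ 2)) = eta_fls 2 ^ 2 / (eta_fls 1 * eta_fls 4)"
    using nz by (simp add: eq_divide_eq mult.assoc del: One_nat_def)
  have e: "fps_to_fls (signed_theta 1 1 oo fps_X ^ 2) = eta_fls 2 ^ 2 / eta_fls 4"
    using signed_theta_compose_X_power(1)[of 2] by (simp del: One_nat_def)
  show "theta 1 0 * (signed_theta 1 1 oo fps_X ^ 2) = 2 * H"
    unfolding H_def fls_eq fls_hom e P fps_to_fls_theta eta_fls_def[symmetric]
    using nz by (simp add: divide_simps del: One_nat_def)
  show "theta 1 1 * signed_theta 1 0 = 2 * H"
    unfolding H_def fls_eq fls_hom e P fps_to_fls_theta fps_to_fls_signed_theta eta_fls_def[symmetric]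
    using nz by (simp add: divide_simps del: One_nat_def) algebra
qed

lemma theta_product_trisect:
  defines "S \<equiv> (M2_03 oo fps_X ^ 3) + fps_X * (M2_13 oo fps_X ^ 3) + fps_X ^ 2 * (M2_23 oo fps_X ^ 3)"
  shows "fps_qpoch (- fps_X) (fps_X ^ 2) * qp 2 ^ 2 = S * qp 6"
proof -
  have X3: "fps_nth (fps_X ^ 3) 0 = (0 :: complex)" and X2: "fps_nth (fps_X ^ 2) 0 = (0 :: complex)"
    by simp_all
  note cX = fps_compose_X_power_mult[symmetric, where 'a = complex]
  note simps = fps_compose_add_distrib fps_compose_sub_distrib fps_compose_mult_distrib[OF X3]
    numeral_compose neg_numeral_compose fps_X_fps_compose_startby0[OF X3]
  let ?C = "\<lambda>f. f oo fps_X ^ 3 :: complex fps"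
  have \<tau>: "theta 1 0 = 2 * ?C (theta 2 1) + fps_X * ?C (theta 1 0 oo fps_X ^ 3)"
    using theta_fps_triangular_trisect[where 'a = complex] cX[of 3 3 "theta 1 0"] by simp
  have \<phi>: "theta 1 1 = ?C (theta 1 1 oo fps_X ^ 3) + 2 * fps_X * ?C (theta 5 1)"
    using theta_fps_square_trisect[where 'a = complex] cX[of 3 3 "theta 1 1"] by simp
  have \<tau>': "signed_theta 1 0 = 2 * ?C (signed_theta 2 1) - fps_X * ?C (signed_theta 1 0 oo fps_X ^ 3)"
    using signed_theta_trisect(2) cX[of 3 3 "signed_theta 1 0"] by simp
  have "signed_theta 1 1 oo fps_X ^ 2
      = (signed_theta 1 1 oo fps_X ^ 9 oo fps_X ^ 2) - 2 * fps_X ^ 2 * (signed_theta 5 1 oo fps_X ^ 3 oo fps_X ^ 2)"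
    using arg_cong[OF signed_theta_trisect(1), of "\<lambda>f. f oo fps_X ^ 2",
        unfolded fps_compose_sub_distrib fps_compose_mult_distrib[OF X2] numeral_compose
          fps_X_fps_compose_startby0[OF X2]] .
  then have \<phi>': "signed_theta 1 1 oo fps_X ^ 2
      = ?C (signed_theta 1 1 oo fps_X ^ 6) - 2 * fps_X ^ 2 * ?C (signed_theta 5 1 oo fps_X ^ 2)"
    by (simp add: fps_compose_X_power_mult)
  \<comment> \<open>The second term comes from classes 1+2; its power q^3 is the
    \<open>fps_X\<close> standing inside the substitution.\<close>
  define f0 where "f0 = 2 * theta 2 1 * (signed_theta 1 1 oo fps_X ^ 6)
    - 2 * fps_X * (theta 1 0 oo fps_X ^ 3) * (signed_theta 5 1 oo fps_X ^ 2)"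
  define g0 where "g0 = 2 * (theta 1 1 oo fps_X ^ 3) * signed_theta 2 1"
  have E1: "theta 1 0 * (signed_theta 1 1 oo fps_X ^ 2)
      = ?C f0 + fps_X * ?C ((theta 1 0 oo fps_X ^ 3) * (signed_theta 1 1 oo fps_X ^ 6))
      + fps_X ^ 2 * ?C (- 4 * theta 2 1 * (signed_theta 5 1 oo fps_X ^ 2))"
    unfolding \<phi>' f0_def simps by (subst \<tau>) (simp add: algebra_simps power2_eq_square power3_eq_cube)
  have E2: "theta 1 1 * signed_theta 1 0
      = ?C g0 + fps_X * ?C (4 * theta 5 1 * signed_theta 2 1
          - (theta 1 1 oo fps_X ^ 3) * (signed_theta 1 0 oo fps_X ^ 3))
      + fps_X ^ 2 * ?C (- 2 * theta 5 1 * (signed_theta 1 0 oo fps_X ^ 3))"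
    unfolding g0_def simps
    by (subst \<phi>, subst \<tau>') (simp add: algebra_simps power2_eq_square power3_eq_cube)
  \<comment> \<open>This turns the difference of two products into a single one; both expansions
    equal the same series 2H.\<close>
  have "f0 = g0"
    by (rule fps_trisection_unique[OF trans[OF trans[OF E1[symmetric]] E2]]) (simp only: theta_product)
  then have f0: "f0 = 2 * (M2_03 * qp 2)"
    by (simp only: g0_def M2_components mult.assoc)
  have f1: "(theta 1 0 oo fps_X ^ 3) * (signed_theta 1 1 oo fps_X ^ 6) = 2 * (M2_13 * qp 2)"
    by (simp only: M2_components mult.assoc[symmetric])
  have "- 4 * theta 2 1 * (signed_theta 5 1 oo fps_X ^ 2)
      = 2 * (- 2 * theta 2 1 * (signed_theta 5 1 oo fps_X ^ 2))"
    by simp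
  also have "\<dots> = 2 * (M2_23 * qp 2)"
    by (simp only: M2_components)
  finally have f2: "- 4 * theta 2 1 * (signed_theta 5 1 oo fps_X ^ 2) = 2 * (M2_23 * qp 2)" .
  have "2 * (fps_qpoch (- fps_X) (fps_X ^ 2) * qp 2 ^ 2) = 2 * (S * ?C (qp 2))"
    unfolding theta_product(1)[symmetric] E1 f0 f1 f2 S_def simps by (simp add: algebra_simps)
  then show ?thesis
    by (simp add: qp_compose_X_power)
qed

theorem theorem2p11:
  fixes \<zeta> :: complex
  assumes "\<zeta> ^ 3 = 1" and "\<zeta> \<noteq> 1"
  shows "Abs_fps (\<lambda>n. \<Sum>\<^sub>\<infinity>m::int. M2 m n * \<zeta> powi m)
    = (M2_03 oo fps_X ^ 3) + fps_X * (M2_13 oo fps_X ^ 3) + fps_X ^ 2 * (M2_23 oo fps_X ^ 3)"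
    (is "?L = ?S")
proof -
  have "\<zeta> \<noteq> 0"
    using assms(1) by auto
  let ?den = "fps_qpoch (fps_const \<zeta> * fps_X ^ 2) (fps_X ^ 2)
      * fps_qpoch (fps_const (inverse \<zeta>) * fps_X ^ 2) (fps_X ^ 2)"
  \<comment> \<open>In the cube root identity with x = p = q^2, the third factor is
    \<open>qp 2\<close>, so one more \<open>qp 2\<close> turns the numerator into H.\<close>
  have "?den * qp 2 = qp 6"
    using fps_qpoch_cube_root_of_unity[OF assms, of "fps_X ^ 2" "fps_X ^ 2"] by (simp flip: power_mult)
  then have "?L * qp 6 = ?L * ?den * qp 2"
    by (simp add: mult.assoc)
  also have "\<dots> = fps_qpoch (- fps_X) (fps_X ^ 2) * qp 2 ^ 2"
    unfolding M2_gf_eval[OF \<open>\<zeta> \<noteq> 0\<close>] by (simp only: mult.assoc power2_eq_square[of "qp 2"])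
  also have "\<dots> = ?S * qp 6"
    by (rule theta_product_trisect)
  finally show ?thesis
    using qp_nonzero[of 6, where 'a = complex] by simp
qed

end
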